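(* Let $F$ be a non-Archimedean local field of characteristic zero with odd residue characteristic, residue field of order $q$, uniformizer $\varpi$; let $D=M_2(F)$, $\mathcal{O}_D=M_2(\mathcal{O}_F)$; let $\psi$ be an unramified additive character of $F$; let $P(Y)=\sum_{i=1}^n\upsilon_iY_i^2$ with $\upsilon_i\in\mathcal{O}_F^\times$. For $\delta\in\mathcal{O}_D\cap D^\times$ and $\gamma\in D^n$ set $$I_0(\delta,\gamma)=\int_{\mathcal{O}_D^n}\mathbf{1}_{\mathcal{O}_D}\big(\delta^{-1}P(Y)\big)\,\psi\!\left(\frac{\mathrm{trd}(\gamma\cdot Y)}{\mathrm{nrd}(\delta)}\right)dY.$$ Write $\delta=\varpi^{v(\delta)}\eta$ (so $\eta\in\mathcal{O}_D\setminus\varpi\mathcal{O}_D$). Then $I_0(\delta,\gamma)=0$ unless $\gamma\in\varpi^{v(\delta)}\mathcal{O}_D^n$ and there exist $M_0\in\mathcal{O}_D$ and $\mu\in\mathcal{O}_F^n\setminus\varpi\mathcal{O}_F^n$ such that $$\gamma\varpi^{-v(\delta)}\eta\in\mu M_0\eta+\mathrm{nrd}(\eta)\mathcal{O}_D^n.\qquad(\ast)$$ Moreover, if $\gamma\in\varpi^{v(\delta)}\mathcal{O}_D^n$, $\gamma':=\gamma\varpi^{-v(\delta)}$, and $(\ast)$ holds for $(M_0,\mu)$, then $$|I_0(\delta,\gamma)|\le\frac{\mathcal{W}(M_0,\eta)\,|\mathrm{nrd}(\eta)|^{3n/2}\,\|\delta\|^n}{\max\big(\|(\gamma'-\gamm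a'^\dagger)\eta\|,|\mathrm{nrd}(\eta)|\big)^{n/2}\max\big(\|\gamma'\|,\|\delta\|\,|\mathrm{nrd}(\eta)|\big)^n}.$$
   Context: $\eta^\dagger$ is the adjugate, $\mathrm{nrd}=\det$, $\mathrm{trd}=\mathrm{tr}$, $\gamma\cdot Y=\sum_i\gamma_iY_i$, and $\gamma'^\dagger$, $(\gamma'-\gamma'^\dagger)\eta$ are taken componentwise; $\mu M_0=(\mu_1M_0,\dots,\mu_nM_0)$. $dY$ is the Haar measure with $\mathrm{vol}(\mathcal{O}_D)=1$, and $dZ$ below likewise. For $x\in D$, $v(x)=\max\{e:x\in\varpi^e\mathcal{O}_D\}$, $\|x\|=q^{-v(x)}$, and for $x\in D^n$, $\|x\|=\max_i\|x_i\|$; $|\cdot|$ is the normalized absolute value on $F$. Fix $N_0\in\mathcal{O}_D$ such that $N=\eta^\dagger N_0\eta$ generates the cyclic $\mathcal{O}_F$-module given by the image of $\{\eta^\dagger A\eta:A\in\mathcal{O}_D\}$ in $\mathcal{O}_D/\mathrm{nrd}(\eta)\mathcal{O}_D$. Define $\Theta:\mathcal{O}_F^n\times\mathcal{O}_D\to(\mathcal{O}_D/\mathcal{O}_D\eta^\dagger)^n$, $(\lambda,Z)\mapsto(\lambda_iZ\eta^\dagger N_0)_i$, and for $M_0\in\mathcal{O}_D$ $$\mathcal{W}(M_0,\eta)=\sup_{\mu\in\mathcal{O}_F^n\setminus\varpi\mathcal{O}_F^n}\int_{\mathcal{O}_D}\mathbf{1}_{\mu M_0\in\Theta(\mathcal{O}_F^n,Z)}\,dZ,$$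 where $\mu M_0$ is reduced into $(\mathcal{O}_D/\mathcal{O}_D\eta^\dagger)^n$ and $\Theta(\mathcal{O}_F^n,Z)=\{\Theta(\lambda,Z):\lambda\in\mathcal{O}_F^n\}$. *)

theory Defs
  imports "HOL-Analysis.Analysis"
begin

section \<open>Non-Archimedean local fields of characteristic zero\<close>

text \<open>
  The metric is the one induced by the normalized absolute value $|x| = $ \<open>dist x 0\<close>.
  The last axiom says that the maximal ideal of the valuation ring is principal and nonzero (so
  the valuation is discrete and nontrivial) and that a generator has absolute value $1/q$, where
  $q$ is the order of the residue field.
\<close>

class nonarch_local_field = field_char_0 + complete_space +
  assumes dist_eq_dist_diff: "dist x y = dist (x - y) 0"
    and dist_mult_0: "dist (x * y) 0 = dist x 0 * dist y 0"
    and dist_ultrametric: "dist x z \<le> max (dist x y) (dist y z)"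
    and finite_residue_classes:
      "finite ({x. dist x 0 \<le> 1} // {(x, y). dist x 0 \<le> 1 \<and> dist y 0 \<le> 1 \<and> dist x y < 1})"
    and ex_uniformizer:
      "\<exists>p. p \<noteq> 0 \<and> {x. dist x 0 < 1} = (*) p ` {x. dist x 0 \<le> 1} \<and>
        dist p 0 = 1 / real (card ({x. dist x 0 \<le> 1} //
          {(x, y). dist x 0 \<le> 1 \<and> dist y 0 \<le> 1 \<and> dist x y < 1}))"

definition absF :: "'f::nonarch_local_field \<Rightarrow> real"
  where "absF x = dist x 0"

definition OF :: "'f::nonarch_local_field set"
  where "OF = {x. absF x \<le> 1}"

definition uniformizer :: "'f::nonarch_local_field \<Rightarrow> bool"
  where "uniformizer p \<longleftrightarrow> p \<noteq> 0 \<and> {x. absF x < 1} = (*) p ` OF"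

definition residue_field :: "'f::nonarch_local_field set set"
  where "residue_field = OF // {(x, y). x \<in> OF \<and> y \<in> OF \<and> absF (x - y) < 1}"

definition residue_card :: "'f::nonarch_local_field itself \<Rightarrow> nat"
  where "residue_card _ = card (residue_field :: 'f set set)"

text \<open>The least positive multiple of 1 that vanishes in the residue field.\<close>

definition residue_char :: "'f::nonarch_local_field itself \<Rightarrow> nat"
  where "residue_char _ = (LEAST k. 0 < k \<and> absF (of_nat k :: 'f) < 1)"

definition additive_character :: "('f::nonarch_local_field \<Rightarrow> complex) \<Rightarrow> bool"
  where "additive_character \<psi> \<longleftrightarrow>
    (\<forall>x y. \<psi> (x + y) = \<psi> x * \<psi> y) \<and> (\<forall>x. cmod (\<psi> x) = 1) \<and> continuous_on UNIV \<psi>"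

text \<open>Unramified: $\mathcal{O}_F$ is the largest fractional ideal on which $\psi$ is trivial.\<close>

definition unramified :: "'f::nonarch_local_field \<Rightarrow> ('f \<Rightarrow> complex) \<Rightarrow> bool"
  where "unramified \<pi> \<psi> \<longleftrightarrow>
    (\<forall>x\<in>OF. \<psi> x = 1) \<and> \<not> (\<forall>x\<in>OF. \<psi> (inverse \<pi> * x) = 1)"


section \<open>The matrix algebra $D = M_2(F)$ and the space $D^n$\<close>

definition adjugate :: "'f::comm_ring_1^2^2 \<Rightarrow> 'f^2^2"
  where "adjugate A = vector [vector [A$2$2, - A$1$2], vector [- A$2$1, A$1$1]]"

definition scaleM :: "'f::comm_ring_1 \<Rightarrow> 'f^2^2 \<Rightarrow> 'f^2^2"  (infixr \<open>*m\<close> 75)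
  where "c *m A = (\<chi> i j. c * A$i$j)"

definition scaleMn :: "'f::comm_ring_1 \<Rightarrow> 'f^2^2^'n \<Rightarrow> 'f^2^2^'n"  (infixr \<open>*mn\<close> 75)
  where "c *mn Y = (\<chi> i. c *m Y$i)"

text \<open>$\mu M = (\mu_1 M, \dots, \mu_n M)$.\<close>

definition tupleM :: "'f::comm_ring_1^'n \<Rightarrow> 'f^2^2 \<Rightarrow> 'f^2^2^'n"
  where "tupleM \<mu> M = (\<chi> i. \<mu>$i *m M)"

definition rmultMn :: "'f::comm_ring_1^2^2^'n \<Rightarrow> 'f^2^2 \<Rightarrow> 'f^2^2^'n"  (infixl \<open>**n\<close> 70)
  where "Y **n A = (\<chi> i. Y$i ** A)"

definition OD :: "('f::nonarch_local_field^2^2) set"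
  where "OD = {A. \<forall>i j. A$i$j \<in> OF}"

definition ODn :: "('f::nonarch_local_field^2^2^'n) set"
  where "ODn = {Y. \<forall>i. Y$i \<in> OD}"

definition OFn :: "('f::nonarch_local_field^'n) set"
  where "OFn = {\<mu>. \<forall>i. \<mu>$i \<in> OF}"

text \<open>$\mathcal{O}_F^n \setminus \varpi\mathcal{O}_F^n$.\<close>

definition primitive :: "'f::nonarch_local_field \<Rightarrow> ('f^'n) set"
  where "primitive \<pi> = OFn - (*s) \<pi> ` OFn"

text \<open>\<open>valD \<pi> x\<close> is only meaningful for $x \neq 0$; the convention $\|0\| = 0$ is built into
  \<open>normD\<close>.\<close>

definition valD :: "'f::nonarch_local_field \<Rightarrow> 'f^2^2 \<Rightarrow> int"
  where "valD \<pi> x = (GREATEST e. x \<in> (*m) (\<pi> powi e) ` OD)"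

definition normD :: "'f::nonarch_local_field \<Rightarrow> 'f^2^2 \<Rightarrow> real"
  where "normD \<pi> x =
    (if x = 0 then 0 else real (residue_card TYPE('f)) powi (- valD \<pi> x))"

definition normDn :: "'f::nonarch_local_field \<Rightarrow> 'f^2^2^'n \<Rightarrow> real"
  where "normDn \<pi> x = Max (range (\<lambda>i. normD \<pi> (x$i)))"


section \<open>Haar measure and the integral $I_0$\<close>

text \<open>
  \<open>M\<close> is the Haar measure normalized by giving \<open>K\<close> volume 1. All groups considered here are
  second countable and locally compact, and \<open>K\<close> is a compact open subgroup, so such a Borel
  measure is automatically Radon and it is unique.
\<close>

definition haar_measure :: "'a::{topological_space, ab_group_add} set \<Rightarrow> 'a measure \<Rightarrow> bool"
  where "haar_measure K M \<longleftrightarrow>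
    sets M = sets borel \<and> (\<forall>a. distr M M ((+) a) = M) \<and> emeasure M K = 1"

definition quadP :: "'f::comm_ring_1^'n \<Rightarrow> 'f^2^2^'n \<Rightarrow> 'f^2^2"
  where "quadP \<upsilon> Y = (\<Sum>i\<in>UNIV. \<upsilon>$i *m (Y$i ** Y$i))"

definition dotD :: "'f::comm_ring_1^2^2^'n \<Rightarrow> 'f^2^2^'n \<Rightarrow> 'f^2^2"
  where "dotD \<gamma> Y = (\<Sum>i\<in>UNIV. \<gamma>$i ** Y$i)"

definition I0 :: "('f::nonarch_local_field^2^2^'n) measure \<Rightarrow> ('f \<Rightarrow> complex) \<Rightarrow> 'f^'n \<Rightarrow>
    'f^2^2 \<Rightarrow> 'f^2^2^'n \<Rightarrow> complex"
  where "I0 dY \<psi> \<upsilon> \<delta> \<gamma> =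
    (LINT Y:ODn|dY. indicator OD (matrix_inv \<delta> ** quadP \<upsilon> Y) *
      \<psi> (trace (dotD \<gamma> Y) / det \<delta>))"


section \<open>The condition $(\ast)$ and the quantity $\mathcal{W}$\<close>

definition star_condition :: "'f::nonarch_local_field \<Rightarrow> 'f^2^2 \<Rightarrow> 'f^2^2 \<Rightarrow> 'f^2^2^'n \<Rightarrow>
    'f^2^2 \<Rightarrow> 'f^'n \<Rightarrow> bool"
  where "star_condition \<pi> \<delta> \<eta> \<gamma> M0 \<mu> \<longleftrightarrow>
    (\<exists>B\<in>ODn. (\<pi> powi (- valD \<pi> \<delta>) *mn \<gamma>) **n \<eta> = tupleM \<mu> M0 **n \<eta> + det \<eta> *mn B)"

text \<open>Classes in $\mathcal{O}_D/\mathrm{nrd}(\eta)\mathcal{O}_D$ and in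
  $\mathcal{O}_D/\mathcal{O}_D\eta^\dagger$, represented as cosets.\<close>

definition class_nrd :: "'f::nonarch_local_field^2^2 \<Rightarrow> 'f^2^2 \<Rightarrow> ('f^2^2) set"
  where "class_nrd \<eta> X = {X + det \<eta> *m B | B. B \<in> OD}"

definition class_adj :: "'f::nonarch_local_field^2^2 \<Rightarrow> 'f^2^2 \<Rightarrow> ('f^2^2) set"
  where "class_adj \<eta> X = {X + B ** adjugate \<eta> | B. B \<in> OD}"

text \<open>The image of $\{\eta^\dagger A \eta : A \in \mathcal{O}_D\}$ in
  $\mathcal{O}_D/\mathrm{nrd}(\eta)\mathcal{O}_D$ is the $\mathcal{O}_F$-module generated by the
  class of $N = \eta^\dagger N_0 \eta$.\<close>

definition cyclic_generator :: "'f::nonarch_local_field^2^2 \<Rightarrow> 'f^2^2 \<Rightarrow> bool"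
  where "cyclic_generator \<eta> N0 \<longleftrightarrow> N0 \<in> OD \<and>
    (\<lambda>A. class_nrd \<eta> (adjugate \<eta> ** A ** \<eta>)) ` OD =
    (\<lambda>c. class_nrd \<eta> (c *m (adjugate \<eta> ** N0 ** \<eta>))) ` OF"

definition reduce_adj :: "'f::nonarch_local_field^2^2 \<Rightarrow> 'f^2^2^'n \<Rightarrow> (('f^2^2) set)^'n"
  where "reduce_adj \<eta> X = (\<chi> i. class_adj \<eta> (X$i))"

definition Theta :: "'f::nonarch_local_field^2^2 \<Rightarrow> 'f^2^2 \<Rightarrow> 'f^'n \<Rightarrow> 'f^2^2 \<Rightarrow> (('f^2^2) set)^'n"
  where "Theta \<eta> N0 l Z = reduce_adj \<eta> (\<chi> i. l$i *m (Z ** adjugate \<eta> ** N0))"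

text \<open>The dimension $n$ enters through the type of $\mu$, hence the type argument.\<close>

definition W :: "'n::finite itself \<Rightarrow> ('f::nonarch_local_field^2^2) measure \<Rightarrow> 'f \<Rightarrow> 'f^2^2 \<Rightarrow>
    'f^2^2 \<Rightarrow> 'f^2^2 \<Rightarrow> real"
  where "W _ dZ \<pi> N0 M0 \<eta> =
    (SUP \<mu>\<in>(primitive \<pi> :: ('f^'n) set).
      LINT Z:OD|dZ. of_bool (reduce_adj \<eta> (tupleM \<mu> M0) \<in> (\<lambda>l. Theta \<eta> N0 l Z) ` OFn))"

end

theory Submission
  imports Defs
begin

text \<open>
  The indicator of $\delta^{-1}P(Y) \in \mathcal{O}_D$ is the average over $A \in \mathcal{O}_D$ of
  $\psi(\mathrm{trd}(A\delta^{-1}P(Y)))$, so $I_0(\delta,\gamma)$ is an average over $A$ of quadratic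
  Gauss sums in $Y$. Up to the scalar $c = \varpi^{v(\delta)}\mathrm{nrd}(\eta)$ the polar form of
  such a sum is given by $X \mapsto CX + XC$ with $C = A\eta^\dagger$. If the sum does not vanish, its
  linear part is represented by the polar form, that is
  $\gamma'_i \equiv \upsilon_i(CY_i + Y_iC)$ modulo $c$; multiplying by $\eta$ from the right removes
  $Y_iC$ modulo $\mathrm{nrd}(\eta)$, and what remains is governed by the cyclic module
  $\{\eta^\dagger Y\eta\}$. This gives $(\ast)$ and shows that only $A$ with
  $\mu M_0 \in \Theta(\mathcal{O}_F^n, A)$ contribute, which accounts for $\mathcal{W}$. The absolute
  value of a nonvanishing sum is the $n/2$-th power of the volume of
  $\{X \in \mathcal{O}_D : CX + XC \in c\mathcal{O}_D\}$, which is at most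
  $(r/\max(\|C\|,r))^2 \cdot r/\max(|\mathrm{tr}\,C|,r)$ with $r = |c|$; finally
  $\|\gamma'\| \le \max(\|C\|,r)$ and
  $\|(\gamma'-\gamma'^\dagger)\eta\| \le \max(|\mathrm{tr}\,C|,|\mathrm{nrd}(\eta)|)$.
  All integrands are periodic modulo a small lattice, so the integrals are treated as averages over
  finite sets of representatives.
\<close>

section \<open>Finite sets of coset representatives\<close>

text \<open>The bound for one Gauss sum is in terms of C and so varies with A, while the claim only
  mentions \<open>\<gamma>'\<close>. Nonvanishing bridges the two: it expresses
  \<open>\<gamma>'\<close> through C, so a large \<open>\<gamma>'\<close> forces a large C and hence
  a small sum, and the resulting bound is uniform over the A that contribute. If l1, l2 are the
  eigenvalues of C, then X |-> CX + XC has the eigenvalues 2 l1, 2 l2 and twice l1 + l2 = tr C. For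
  tr C = 0 its rank is at most two; this is why the volume of the kernel is measured by the norm of
  C twice and by a third factor that degenerates with the trace. Origin of the exponents: write D =
  |nrd(\<open>\<eta>\<close>)| and m1, m2 for the two maxima in the denominator. The square of the
  bound is the n-th power of D r^2 / (m1 m2^2), and D r^2 = D^3 |\<open>\<delta>\<close>|^2 with the
  norm of \<open>\<delta>\<close>. One factor is D and not r because the trace of C is compared with
  \<open>\<gamma>'\<close> only modulo nrd(\<open>\<eta>\<close>). Odd residue characteristic makes
  2 a unit. This serves to recover the quadratic part of a phase from its polar form and to
  eliminate unknowns from the entries of CX + XC.\<close>

locale transversal =
  fixes K H R :: "'a::ab_group_add set"
  assumes K_zero: "0 \<in> K" and K_diff: "\<And>x y. x \<in> K \<Longrightarrow> y \<in> K \<Longrightarrow> x - y \<in> K"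
    and H_zero: "0 \<in> H" and H_diff: "\<And>x y. x \<in> H \<Longrightarrow> y \<in> H \<Longrightarrow> x - y \<in> H"
    and H_subset: "H \<subseteq> K" and finite_R: "finite R" and R_subset: "R \<subseteq> K"
    and ex1_rep: "\<And>x. x \<in> K \<Longrightarrow> \<exists>!r. r \<in> R \<and> x - r \<in> H"
begin

lemma K_minus: "x \<in> K \<Longrightarrow> - x \<in> K"
  using K_diff[OF K_zero] by simp

lemma K_add: "x \<in> K \<Longrightarrow> y \<in> K \<Longrightarrow> x + y \<in> K"
  using K_diff[of x "- y"] K_minus[of y] by simp

lemma H_minus: "x \<in> H \<Longrightarrow> - x \<in> H"
  using H_diff[OF H_zero] by simp

lemma H_add: "x \<in> H \<Longrightarrow> y \<in> H \<Longrightarrow> x + y \<in> H"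
  using H_diff[of x "- y"] H_minus[of y] by simp

definition rep where "rep x = (THE r. r \<in> R \<and> x - r \<in> H)"

lemma rep: "rep x \<in> R" "x - rep x \<in> H" if "x \<in> K"
  using theI'[OF ex1_rep[OF that]] by (simp_all add: rep_def)

lemma R_cong_eq: "r = s" if "r \<in> R" "s \<in> R" "r - s \<in> H"
  using ex1_rep[of r] that R_subset H_zero by (metis diff_self subsetD)

lemma rep_eq_iff: "rep x = rep y \<longleftrightarrow> x - y \<in> H" if "x \<in> K" "y \<in> K"
proof
  assume "rep x = rep y"
  then show "x - y \<in> H" using H_diff[OF rep(2)[OF that(1)] rep(2)[OF that(2)]] by simp
next
  assume "x - y \<in> H"
  then have "rep x - rep y \<in> H"
    using H_add[OF H_diff[OF _ rep(2)[OF that(1)]] rep(2)[OF that(2)], of "x - y"] by simp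
  then show "rep x = rep y" using R_cong_eq rep(1) that by blast
qed

lemma R_nonempty: "R \<noteq> {}"
  using rep(1)[OF K_zero] by auto

lemma card_R_pos: "0 < card R"
  using R_nonempty finite_R by (simp add: card_gt_0_iff)

lemma periodic_cong: "f x = f y"
  if "\<And>x h. x \<in> K \<Longrightarrow> h \<in> H \<Longrightarrow> f (x + h) = f x" "y \<in> K" "x - y \<in> H"
  using that(1)[OF that(2,3)] by simp

text \<open>Adding \<open>a\<close> permutes the cosets of \<open>H\<close>. Reducing
  \<open>r + a\<close> back into \<open>R\<close> is an injective self-map of a finite set, hence a
  bijection, and periodicity makes the reduction invisible to \<open>f\<close>.\<close>

lemma sum_shift:
  fixes f :: "'a \<Rightarrow> 'b::comm_monoid_add"
  assumes per: "\<And>x h. x \<in> K \<Longrightarrow> h \<in> H \<Longrightarrow> f (x + h) = f x" and a: "a \<in> K"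
  shows "(\<Sum>r\<in>R. f (r + a)) = (\<Sum>r\<in>R. f r)"
proof -
  have K': "r + a \<in> K" if "r \<in> R" for r using that R_subset a K_add by blast
  have inj: "inj_on (\<lambda>r. rep (r + a)) R"
    by (auto simp: inj_on_def rep_eq_iff K' intro: R_cong_eq)
  have "(\<lambda>r. rep (r + a)) ` R \<subseteq> R" using rep(1) K' by auto
  then have bij: "bij_betw (\<lambda>r. rep (r + a)) R R"
    using endo_inj_surj[OF finite_R _ inj] inj by (auto simp: bij_betw_def)
  have "f (r + a) = f (rep (r + a))" if "r \<in> R" for r
    by (rule periodic_cong[OF per]) (use rep[OF K'[OF that]] R_subset in auto)
  then show ?thesis using sum.reindex_bij_betw[OF bij, of f] by simp
qed

lemma sum_character:
  fixes \<xi> :: "'a \<Rightarrow> complex"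
  assumes mult: "\<And>x y. x \<in> K \<Longrightarrow> y \<in> K \<Longrightarrow> \<xi> (x + y) = \<xi> x * \<xi> y"
    and triv: "\<And>h. h \<in> H \<Longrightarrow> \<xi> h = 1"
  shows "(\<Sum>r\<in>R. \<xi> r) = (if \<forall>x\<in>K. \<xi> x = 1 then of_nat (card R) else 0)"
proof (cases "\<forall>x\<in>K. \<xi> x = 1")
  case True
  then have "(\<Sum>r\<in>R. \<xi> r) = (\<Sum>r\<in>R. 1)" using R_subset by (intro sum.cong) auto
  with True show ?thesis by simp
next
  case False
  then obtain a where a: "a \<in> K" "\<xi> a \<noteq> 1" by auto
  have "(\<Sum>r\<in>R. \<xi> r) = (\<Sum>r\<in>R. \<xi> (r + a))"
    by (rule sum_shift[symmetric]) (use a mult triv H_subset in auto)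
  also have "\<dots> = (\<Sum>r\<in>R. \<xi> r) * \<xi> a"
    using mult a R_subset by (auto simp: sum_distrib_right intro!: sum.cong)
  finally have "(\<Sum>r\<in>R. \<xi> r) * (\<xi> a - 1) = 0" by (simp add: algebra_simps)
  then have "(\<Sum>r\<in>R. \<xi> r) = 0" using a(2) by simp
  then show ?thesis by (simp add: False)
qed

text \<open>Weyl squaring: once the inner variable is shifted by \<open>y\<close>, the factor
  \<open>f y\<close> cancels its conjugate, and the sum over \<open>y\<close> is a character sum
  that vanishes unless \<open>x\<close> lies in the radical of \<open>\<beta>\<close>. On the
  radical \<open>f\<close> need not be constant, so its values are only bounded by 1.\<close>

lemma quadratic_sum_norm:
  fixes f :: "'a \<Rightarrow> complex"
  assumes per: "\<And>x h. x \<in> K \<Longrightarrow> h \<in> H \<Longrightarrow> f (x + h) = f x"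
    and norm: "\<And>x. x \<in> K \<Longrightarrow> cmod (f x) = 1"
    and quad: "\<And>x y. x \<in> K \<Longrightarrow> y \<in> K \<Longrightarrow> f (x + y) = f x * f y * \<beta> x y"
    and mult: "\<And>x y z. x \<in> K \<Longrightarrow> y \<in> K \<Longrightarrow> z \<in> K \<Longrightarrow> \<beta> x (y + z) = \<beta> x y * \<beta> x z"
    and triv: "\<And>x h. x \<in> K \<Longrightarrow> h \<in> H \<Longrightarrow> \<beta> x h = 1"
  shows "(cmod (\<Sum>r\<in>R. f r))\<^sup>2 \<le> card R * card {x \<in> R. \<forall>y\<in>K. \<beta> x y = 1}"
proof -
  let ?S = "{x \<in> R. \<forall>y\<in>K. \<beta> x y = 1}"
  have *: "f x * cnj (f x) = 1" if "x \<in> K" for x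
    using norm[OF that] by (metis complex_norm_square mult.commute of_real_1 one_power2)
  have "(\<Sum>r\<in>R. f r) * cnj (\<Sum>r\<in>R. f r) = (\<Sum>y\<in>R. cnj (f y) * (\<Sum>x\<in>R. f x))"
    by (subst mult.commute) (simp only: cnj_sum sum_distrib_right)
  also have "\<dots> = (\<Sum>y\<in>R. cnj (f y) * (\<Sum>x\<in>R. f (x + y)))"
    using sum_shift[OF per] R_subset by (intro sum.cong) auto
  also have "\<dots> = (\<Sum>y\<in>R. \<Sum>x\<in>R. f x * \<beta> x y)"
    unfolding sum_distrib_left
  proof (intro sum.cong refl)
    fix y x assume "y \<in> R" "x \<in> R"
    then have "x \<in> K" "y \<in> K" using R_subset by auto
    then show "cnj (f y) * f (x + y) = f x * \<beta> x y"
      using quad[of x y] *[of y] by (simp add: mult_ac)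
  qed
  also have "\<dots> = (\<Sum>x\<in>R. f x * (\<Sum>y\<in>R. \<beta> x y))"
    by (subst sum.swap) (simp add: sum_distrib_left)
  also have "\<dots> = (\<Sum>x\<in>R. if x \<in> ?S then f x * of_nat (card R) else 0)"
    using R_subset by (intro sum.cong refl) (auto simp: sum_character mult triv subset_iff)
  also have "\<dots> = (\<Sum>x\<in>?S. f x * of_nat (card R))"
    by (subst sum.inter_filter[symmetric]) (auto simp: finite_R)
  finally have eq: "(\<Sum>r\<in>R. f r) * cnj (\<Sum>r\<in>R. f r) = (\<Sum>x\<in>?S. f x * of_nat (card R))" .
  have "(cmod (\<Sum>r\<in>R. f r))\<^sup>2 = cmod ((\<Sum>r\<in>R. f r) * cnj (\<Sum>r\<in>R. f r))"
    by (simp add: norm_mult power2_eq_square del: cnj_sum)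
  also have "\<dots> \<le> (\<Sum>x\<in>?S. cmod (f x * of_nat (card R)))"
    unfolding eq by (rule norm_sum)
  also have "\<dots> = (\<Sum>x\<in>?S. real (card R))"
    using R_subset by (intro sum.cong refl) (auto simp: norm_mult norm subset_iff)
  finally show ?thesis by (simp add: mult.commute)
qed

text \<open>A shift by an element \<open>a\<close> of the radical multiplies the whole sum by
  \<open>f a\<close> but also leaves it unchanged.\<close>

lemma quadratic_sum_nonzero:
  fixes f :: "'a \<Rightarrow> complex"
  assumes per: "\<And>x h. x \<in> K \<Longrightarrow> h \<in> H \<Longrightarrow> f (x + h) = f x"
    and quad: "\<And>x y. x \<in> K \<Longrightarrow> y \<in> K \<Longrightarrow> f (x + y) = f x * f y * \<beta> x y"
    and nz: "(\<Sum>r\<in>R. f r) \<noteq> 0" and a: "a \<in> K" and rad: "\<And>y. y \<in> K \<Longrightarrow> \<beta> y a = 1"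
  shows "f a = 1"
proof -
  have "(\<Sum>r\<in>R. f r) = (\<Sum>r\<in>R. f (r + a))" using sum_shift[OF per a] by simp
  also have "\<dots> = (\<Sum>r\<in>R. f r) * f a"
    unfolding sum_distrib_right using R_subset quad a rad by (intro sum.cong) (auto simp: subset_iff)
  finally have "(\<Sum>r\<in>R. f r) * (f a - 1) = 0" by (simp add: algebra_simps)
  with nz show ?thesis by simp
qed

text \<open>Both sums of the double sum of \<open>\<xi> x * cnj (\<beta> x y)\<close> collapse by orthogonality: the sum over
  \<open>y\<close> first shows that it is positive, so the sum over \<open>x\<close> is nonzero for some \<open>y\<close>.\<close>

lemma character_trivial_on_radical:
  fixes \<xi> :: "'a \<Rightarrow> complex"
  assumes chi: "\<And>x y. x \<in> K \<Longrightarrow> y \<in> K \<Longrightarrow> \<xi> (x + y) = \<xi> x * \<xi> y"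
    and norm: "\<And>x y. x \<in> K \<Longrightarrow> y \<in> K \<Longrightarrow> cmod (\<beta> x y) = 1"
    and mult: "\<And>x y z. x \<in> K \<Longrightarrow> y \<in> K \<Longrightarrow> z \<in> K \<Longrightarrow> \<beta> x (y + z) = \<beta> x y * \<beta> x z"
    and mult': "\<And>x y z. x \<in> K \<Longrightarrow> y \<in> K \<Longrightarrow> z \<in> K \<Longrightarrow> \<beta> (x + y) z = \<beta> x z * \<beta> y z"
    and triv: "\<And>x h. x \<in> K \<Longrightarrow> h \<in> H \<Longrightarrow> \<beta> x h = 1"
    and triv': "\<And>x h. x \<in> K \<Longrightarrow> h \<in> H \<Longrightarrow> \<beta> h x = 1"
    and rad: "\<And>x. x \<in> K \<Longrightarrow> (\<And>y. y \<in> K \<Longrightarrow> \<beta> x y = 1) \<Longrightarrow> \<xi> x = 1"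
  obtains y where "y \<in> K" "\<And>x. x \<in> K \<Longrightarrow> \<xi> x = \<beta> x y"
proof -
  let ?S = "{x \<in> R. \<forall>y\<in>K. \<beta> x y = 1}"
  have inv: "\<beta> x y * cnj (\<beta> x y) = 1" if "x \<in> K" "y \<in> K" for x y
    using norm[OF that] by (metis complex_norm_square mult.commute of_real_1 one_power2)
  have chiH: "\<xi> h = 1" if "h \<in> H" for h using rad[of h] that triv' H_subset by auto
  \<comment> \<open>\<open>0\<close> itself may fail to lie in \<open>R\<close>; the representative
    of the coset \<open>H\<close> is the witness that the radical meets \<open>R\<close>.\<close>
  have "rep 0 \<in> H" using rep(2)[OF K_zero] H_minus by fastforce
  then have "rep 0 \<in> ?S" using rep(1)[OF K_zero] triv' by auto
  then have card: "card ?S > 0" using finite_R by (auto simp: card_gt_0_iff)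
  have "(\<Sum>y\<in>R. \<Sum>x\<in>R. \<xi> x * cnj (\<beta> x y)) = (\<Sum>x\<in>R. \<xi> x * cnj (\<Sum>y\<in>R. \<beta> x y))"
    by (subst sum.swap) (simp add: sum_distrib_left)
  also have "\<dots> = (\<Sum>x\<in>R. if x \<in> ?S then of_nat (card R) else 0)"
    using R_subset by (intro sum.cong refl) (auto simp: sum_character mult triv subset_iff rad)
  also have "\<dots> = of_nat (card ?S * card R)"
    by (subst sum.inter_filter[symmetric]) (auto simp: finite_R)
  finally have "(\<Sum>y\<in>R. \<Sum>x\<in>R. \<xi> x * cnj (\<beta> x y)) = of_nat (card ?S * card R)" .
  moreover have "of_nat (card ?S * card R) \<noteq> (0::complex)"
    using card card_R_pos by (simp del: of_nat_mult)
  ultimately have "(\<Sum>y\<in>R. \<Sum>x\<in>R. \<xi> x * cnj (\<beta> x y)) \<noteq> 0" by simp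
  then obtain y where y: "y \<in> R" "(\<Sum>x\<in>R. \<xi> x * cnj (\<beta> x y)) \<noteq> 0"
    by (meson sum.neutral)
  then have yK: "y \<in> K" using R_subset by auto
  \<comment> \<open>For fixed \<open>y\<close> the product is a character of \<open>K\<close>
    trivial on \<open>H\<close>; its sum is nonzero, so it is the trivial character.\<close>
  have "\<forall>x\<in>K. \<xi> x * cnj (\<beta> x y) = 1"
    using y(2) sum_character[of "\<lambda>x. \<xi> x * cnj (\<beta> x y)"] yK
    by (auto simp: chi mult' triv' chiH split: if_splits)
  then have "\<xi> x = \<beta> x y" if "x \<in> K" for x
    using inv[OF that yK] that by (metis mult.assoc mult.commute mult.right_neutral)
  then show ?thesis using that yK by blast
qed

text \<open>An index estimate: elements of \<open>T\<close> lie in different cosets of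
  \<open>S\<close>, so the translates of \<open>R \<inter> S\<close> by \<open>T\<close> occupy
  distinct cosets of \<open>H\<close>.\<close>

lemma card_subgroup_le:
  assumes S: "\<And>x y. x \<in> S \<Longrightarrow> y \<in> S \<Longrightarrow> x - y \<in> S" and HS: "H \<subseteq> S"
    and T: "finite T" "T \<subseteq> K" "\<And>s t. s \<in> T \<Longrightarrow> t \<in> T \<Longrightarrow> s - t \<in> S \<Longrightarrow> s = t"
  shows "card T * card (R \<inter> S) \<le> card R"
proof -
  let ?g = "\<lambda>(t, s). rep (t + s)"
  have "inj_on ?g (T \<times> (R \<inter> S))"
  proof (rule inj_onI, clarify)
    fix t s t' s' assume ts: "t \<in> T" "t' \<in> T" "s \<in> R" "s \<in> S" "s' \<in> R" "s' \<in> S"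
      and eq: "rep (t + s) = rep (t' + s')"
    have K': "t + s \<in> K" "t' + s' \<in> K" using ts T(2) R_subset K_add by blast+
    have h: "t + s - (t' + s') \<in> H" using eq rep_eq_iff[OF K'] by simp
    have "t - t' \<in> S" using S[OF subsetD[OF HS h] S[OF ts(4,6)]] by (simp add: algebra_simps)
    then have "t = t'" using T(3) ts by blast
    then show "t = t' \<and> s = s'" using h R_cong_eq ts by simp
  qed
  moreover have "?g ` (T \<times> (R \<inter> S)) \<subseteq> R"
    using rep(1) K_add T(2) R_subset by (auto simp: subset_iff)
  ultimately have "card (T \<times> (R \<inter> S)) \<le> card R"
    using finite_R card_inj_on_le by blast
  then show ?thesis by (simp add: card_cartesian_product)
qed

end

text \<open>By invariance the cosets of \<open>H\<close> in \<open>K\<close> all have measure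
  \<open>1 / card R\<close>, and on \<open>K\<close> the integrand is a simple function. The sort of
  \<open>'a\<close> does not tie its topology to addition, so continuity of translations is a
  hypothesis.\<close>

lemma haar_integral_transversal:
  fixes M :: "'a::{topological_space, ab_group_add} measure"
    and f :: "'a \<Rightarrow> 'b::{banach, second_countable_topology}"
  assumes "transversal K H R" and M: "haar_measure K M"
    and cont: "\<And>a::'a. continuous_on UNIV ((+) a)" and H: "open H"
    and per: "\<And>x h. x \<in> K \<Longrightarrow> h \<in> H \<Longrightarrow> f (x + h) = f x"
  shows "(LINT x:K|M. f x) = (\<Sum>r\<in>R. f r) /\<^sub>R card R"
proof -
  interpret transversal K H R by fact
  have sets: "sets M = sets borel" and space: "space M = UNIV"
    and inv: "\<And>a. distr M M ((+) a) = M" and one: "emeasure M K = 1"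
    using M sets_eq_imp_space_eq[of M borel] by (auto simp: haar_measure_def)
  define C where "C r = (+) (- r) -` H" for r
  have C_iff: "x \<in> C r \<longleftrightarrow> x - r \<in> H" for x r by (simp add: C_def)
  have meas: "(+) a \<in> measurable M M" for a
    using borel_measurable_continuous_onI[OF cont] measurable_cong_sets[OF sets sets] by blast
  have Hs: "H \<in> sets M" using H sets by simp
  have Cs: "C r \<in> sets M" for r
    using measurable_sets[OF meas Hs] space by (simp add: C_def)
  have emC: "emeasure M (C r) = emeasure M H" for r
    using emeasure_distr[OF meas Hs, of "- r"] inv[of "- r"] space by (simp add: C_def)
  have disj: "disjoint_family_on C R"
  proof (unfold disjoint_family_on_def, intro ballI impI equals0I)
    fix r s x assume rs: "r \<in> R" "s \<in> R" "r \<noteq> s" and "x \<in> C r \<inter> C s"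
    then have "x - s - (x - r) \<in> H" using H_diff C_iff by blast
    then show False using R_cong_eq rs by simp
  qed
  have K_eq: "K = (\<Union>r\<in>R. C r)"
  proof (intro equalityI subsetI)
    fix x assume "x \<in> K" then show "x \<in> (\<Union>r\<in>R. C r)" using rep C_iff by blast
  next
    fix x assume "x \<in> (\<Union>r\<in>R. C r)"
    then obtain r where "r \<in> K" "x - r \<in> K" using C_iff R_subset H_subset by blast
    then show "x \<in> K" using K_add by fastforce
  qed
  have "1 = (\<Sum>r\<in>R. emeasure M (C r))"
    using sum_emeasure[OF _ disj finite_R, of M] Cs one K_eq by (auto simp: image_subset_iff)
  \<comment> \<open>Besides fixing the measure of \<open>H\<close>, this equation excludes the value
    infinity, which integrability of the indicators requires.\<close>
  then have em: "of_nat (card R) * emeasure M H = 1" by (simp add: emC)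
  then have fin: "emeasure M H < \<infinity>"
    using card_R_pos by (auto simp: less_top[symmetric] ennreal_mult_top)
  have "measure M H = 1 / card R"
  proof -
    have "enn2real (of_nat (card R) * emeasure M H) = 1" using em by simp
    then have "card R * measure M H = 1" by (simp add: enn2real_mult measure_def)
    then show ?thesis using card_R_pos by (simp add: field_simps)
  qed
  then have mC: "measure M (C r) = 1 / card R" for r using emC by (simp add: measure_def)
  have ind: "indicator K x *\<^sub>R f x = (\<Sum>r\<in>R. indicator (C r) x *\<^sub>R f r)" for x
  proof (cases "x \<in> K")
    case True
    have "indicator (C r) x *\<^sub>R f r = (if r = rep x then f x else 0)" if "r \<in> R" for r
    proof (cases "r = rep x")
      case True
      have "f x = f (rep x)"
        by (rule periodic_cong[OF per]) (use rep[OF \<open>x \<in> K\<close>] R_subset in auto)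
      then show ?thesis using True rep(2)[OF \<open>x \<in> K\<close>] C_iff by simp
    next
      case False
      then have "x \<notin> C r" using ex1_rep[OF \<open>x \<in> K\<close>] rep[OF \<open>x \<in> K\<close>] that C_iff by auto
      then show ?thesis using False by simp
    qed
    then have "(\<Sum>r\<in>R. indicator (C r) x *\<^sub>R f r) = f x"
      using rep(1)[OF True] finite_R by simp
    then show ?thesis using True by simp
  next
    case False
    then show ?thesis using K_eq by (auto simp: indicator_def intro!: sum.neutral)
  qed
  have "(LINT x:K|M. f x) = (LINT x|M. (\<Sum>r\<in>R. indicator (C r) x *\<^sub>R f r))"
    by (simp add: set_lebesgue_integral_def ind)
  also have "\<dots> = (\<Sum>r\<in>R. (LINT x|M. indicator (C r) x *\<^sub>R f r))"
    by (rule Bochner_Integration.integral_sum)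
       (intro integrable_scaleR_left integrable_real_indicator, use Cs emC fin in auto)
  also have "\<dots> = (\<Sum>r\<in>R. f r /\<^sub>R card R)"
    using Cs emC fin mC by (intro sum.cong refl) (simp add: inverse_eq_divide space)
  finally show ?thesis by (simp add: scaleR_sum_right)
qed

section \<open>Transversals of finite powers\<close>

lemma finite_card_vec:
  assumes "finite R"
  shows "finite {x::'a^'n. \<forall>i. x$i \<in> R}" "card {x::'a^'n. \<forall>i. x$i \<in> R} = card R ^ CARD('n)"
proof -
  have "bij_betw vec_nth {x::'a^'n. \<forall>i. x$i \<in> R} (PiE UNIV (\<lambda>_. R))"
    by (rule bij_betwI[where g = vec_lambda]) (auto simp: PiE_def)
  moreover have "finite (PiE (UNIV::'n set) (\<lambda>_. R))" using assms by (simp add: finite_PiE)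
  moreover have "card (PiE (UNIV::'n set) (\<lambda>_. R)) = card R ^ CARD('n)" by (simp add: card_PiE)
  ultimately show "finite {x::'a^'n. \<forall>i. x$i \<in> R}"
      "card {x::'a^'n. \<forall>i. x$i \<in> R} = card R ^ CARD('n)"
    by (auto simp: bij_betw_finite dest: bij_betw_same_card)
qed

text \<open>Iterating this passes from entries to rows, from rows to matrices and from matrices to
  tuples of matrices.\<close>

lemma transversal_vec:
  assumes "transversal K H R"
  shows "transversal {x::'a::ab_group_add^'n. \<forall>i. x$i \<in> K} {x. \<forall>i. x$i \<in> H} {x. \<forall>i. x$i \<in> R}"
proof -
  interpret transversal K H R by fact
  show ?thesis
  proof (unfold_locales; (simp add: K_zero H_zero K_diff H_diff finite_card_vec(1) finite_R; fail)?)
    show "{x. \<forall>i. x$i \<in> H} \<subseteq> {x::'a^'n. \<forall>i. x$i \<in> K}" using H_subset by auto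
    show "{x. \<forall>i. x$i \<in> R} \<subseteq> {x::'a^'n. \<forall>i. x$i \<in> K}" using R_subset by auto
    fix x :: "'a^'n" assume x: "x \<in> {x. \<forall>i. x$i \<in> K}"
    show "\<exists>!r. r \<in> {x. \<forall>i. x$i \<in> R} \<and> x - r \<in> {x. \<forall>i. x$i \<in> H}"
    proof (rule ex1I[of _ "\<chi> i. rep (x$i)"])
      show "(\<chi> i. rep (x$i)) \<in> {x. \<forall>i. x$i \<in> R} \<and> x - (\<chi> i. rep (x$i)) \<in> {x. \<forall>i. x$i \<in> H}"
        using x rep by simp
      fix r :: "'a^'n" assume "r \<in> {x. \<forall>i. x$i \<in> R} \<and> x - r \<in> {x. \<forall>i. x$i \<in> H}"
      then show "r = (\<chi> i. rep (x$i))"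
        using x rep ex1_rep by (auto simp: vec_eq_iff) (metis)
    qed
  qed
qed

lemma continuous_on_add_left_vec:
  assumes "\<And>a::'a::{topological_space, ab_group_add}. continuous_on UNIV ((+) a)"
  shows "continuous_on UNIV ((+) (b::'a^'n))"
proof -
  have "(+) b = (\<lambda>x. \<chi> i. b$i + x$i)" by (auto simp: vec_eq_iff)
  moreover have "continuous_on UNIV (\<lambda>x. \<chi> i. b$i + (x::'a^'n)$i)"
    by (intro continuous_on_vec_lambda continuous_on_compose2[OF assms]
        continuous_on_component continuous_on_id) auto
  ultimately show ?thesis by simp
qed

section \<open>The absolute value\<close>

lemma absF_0[simp]: "absF 0 = 0"
  by (simp add: absF_def)

lemma absF_nonneg[simp]: "0 \<le> absF x"
  by (simp add: absF_def)

lemma absF_eq_0_iff[simp]: "absF x = 0 \<longleftrightarrow> x = 0"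
  by (simp add: absF_def)

lemma absF_le_0_iff[simp]: "absF x \<le> 0 \<longleftrightarrow> x = 0"
  by (simp add: absF_def)

lemma absF_pos_iff[simp]: "0 < absF x \<longleftrightarrow> x \<noteq> 0"
  by (simp add: absF_def)

lemma absF_mult: "absF (x * y) = absF x * absF y"
  by (simp add: absF_def dist_mult_0)

lemma absF_1[simp]: "absF (1::'f::nonarch_local_field) = 1"
proof -
  have "absF (1::'f) = absF (1::'f) * absF (1::'f)" using absF_mult[of "1::'f" 1] by (simp only: mult_1_left)
  then show ?thesis by simp
qed

lemma absF_minus[simp]: "absF (- x) = absF x"
proof -
  have "absF (-1::'a) * absF (-1::'a) = 1" using absF_mult[of "-1::'a" "-1"] by simp
  then have "absF (-1::'a) = 1"
    using square_eq_1_iff[of "absF (-1::'a)"] absF_nonneg[of "-1::'a"] by linarith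
  then show ?thesis using absF_mult[of "-1" x] by simp
qed

lemma absF_minus_commute: "absF (x - y) = absF (y - x)"
  using absF_minus[of "x - y"] by simp

lemma absF_diff_le: "absF (x - y) \<le> max (absF x) (absF y)"
  using dist_ultrametric[of x y 0] dist_eq_dist_diff[of x y] by (simp add: absF_def dist_commute)

lemma absF_add_le: "absF (x + y) \<le> max (absF x) (absF y)"
  using absF_diff_le[of x "- y"] by simp

lemma absF_add_leI: "absF x \<le> c \<Longrightarrow> absF y \<le> c \<Longrightarrow> absF (x + y) \<le> c"
  using absF_add_le[of x y] by linarith

lemma absF_diff_leI: "absF x \<le> c \<Longrightarrow> absF y \<le> c \<Longrightarrow> absF (x - y) \<le> c"
  using absF_diff_le[of x y] by linarith

lemma absF_sum_le: "0 \<le> c \<Longrightarrow> (\<And>i. i \<in> I \<Longrightarrow> absF (f i) \<le> c) \<Longrightarrow> absF (sum f I) \<le> c"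
  by (induction I rule: infinite_finite_induct) (auto intro: absF_add_leI)

lemma absF_add_eq: "absF y < absF x \<Longrightarrow> absF (x + y) = absF x"
  using absF_add_le[of x y] absF_diff_le[of "x + y" y] by simp

lemma absF_inverse: "absF (inverse x) = inverse (absF x)"
proof (cases "x = 0")
  case False
  then have "absF x * absF (inverse x) = 1" by (simp flip: absF_mult)
  then show ?thesis by (simp add: inverse_unique)
qed simp

lemma absF_divide: "absF (x / y) = absF x / absF y"
  by (simp add: divide_inverse absF_mult absF_inverse)

lemma absF_power: "absF (x ^ n) = absF x ^ n"
  by (induction n) (auto simp: absF_mult)

lemma absF_powi: "absF (x powi k) = absF x powi k"
  by (simp add: power_int_def absF_power absF_inverse)

lemma OF_iff: "x \<in> OF \<longleftrightarrow> absF x \<le> 1"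
  by (simp add: OF_def)

lemma open_ball_absF:
  assumes "0 < r"
  shows "open {x::'f::nonarch_local_field. absF x \<le> r}"
proof (unfold open_dist, intro ballI exI[of _ r] conjI allI impI assms)
  fix x y :: 'f assume "x \<in> {x. absF x \<le> r}" "dist y x < r"
  then show "y \<in> {x. absF x \<le> r}"
    using absF_add_leI[of x r "y - x"] by (simp add: absF_def dist_eq_dist_diff[of y x])
qed

lemma continuous_on_add_left_absF: "continuous_on UNIV ((+) (a::'f::nonarch_local_field))"
proof -
  have "dist (a + x) (a + y) = dist x y" for x y :: 'f
    using dist_eq_dist_diff[of "a + x" "a + y"] dist_eq_dist_diff[of x y] by simp
  then show ?thesis by (auto simp: continuous_on_iff)
qed

section \<open>Discreteness of the valuation\<close>

text \<open>The class axiom speaks of one generator \<open>p\<close> of the maximal ideal. Any other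
  generator and \<open>p\<close> divide each other in \<open>OF\<close>, so they have equal absolute
  value.\<close>

lemma residue_card_props:
  fixes \<pi> :: "'f::nonarch_local_field"
  assumes "uniformizer \<pi>"
  shows "absF \<pi> = 1 / residue_card TYPE('f)" "2 \<le> residue_card TYPE('f)"
proof -
  have *: "residue_card TYPE('f) = card ({x::'f. dist x 0 \<le> 1} //
          {(x, y). dist x 0 \<le> 1 \<and> dist y 0 \<le> 1 \<and> dist x y < 1})"
    by (simp add: residue_card_def residue_field_def OF_def absF_def dist_eq_dist_diff[symmetric])
  obtain p :: 'f where p: "p \<noteq> 0" "{x. absF x < 1} = (*) p ` OF"
      "absF p = 1 / residue_card TYPE('f)"
    using ex_uniformizer[where 'a = 'f] unfolding * by (auto simp: absF_def OF_def)
  have \<pi>: "\<pi> \<noteq> 0" "{x. absF x < 1} = (*) \<pi> ` OF"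
    using assms by (auto simp: uniformizer_def)
  have one: "1 \<in> (OF::'f set)" by (simp add: OF_iff)
  have less: "absF p < 1" "absF \<pi> < 1"
    using p(2) \<pi>(2) one by (metis mem_Collect_eq imageI mult.right_neutral)+
  have "p \<in> (*) \<pi> ` OF" "\<pi> \<in> (*) p ` OF"
    using less unfolding p(2)[symmetric] \<pi>(2)[symmetric] by simp_all
  then obtain u w where u: "p = \<pi> * u" "u \<in> OF" and w: "\<pi> = p * w" "w \<in> OF" by blast
  have "absF (\<pi> * u) \<le> absF \<pi>" using u(2) by (auto simp: absF_mult OF_iff intro!: mult_left_le)
  moreover have "absF (p * w) \<le> absF p"
    using w(2) by (auto simp: absF_mult OF_iff intro!: mult_left_le)
  ultimately have "absF p = absF \<pi>" unfolding u(1)[symmetric] w(1)[symmetric] by simp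
  then show "absF \<pi> = 1 / residue_card TYPE('f)" using p(3) by simp
  show "2 \<le> residue_card TYPE('f)"
  proof (rule ccontr)
    assume "\<not> ?thesis"
    \<comment> \<open>Cardinality 0 gives \<open>p = 0\<close> because \<open>1 / 0 = 0\<close>;
      cardinality 1 gives \<open>absF p = 1\<close>, too large for the maximal ideal.\<close>
    then have "residue_card TYPE('f) = 0 \<or> residue_card TYPE('f) = 1" by auto
    then show False using p(1,3) less(1) by auto
  qed
qed

locale local_field =
  fixes \<pi> :: "'f::nonarch_local_field"
  assumes unif: "uniformizer \<pi>"
begin

definition q :: real where "q = residue_card TYPE('f)"

lemma q_ge_2: "2 \<le> q"
  using residue_card_props(2)[OF unif] by (simp add: q_def)

lemma q_gt_1: "1 < q" and q_pos: "0 < q"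
  using q_ge_2 by auto

lemma absF_pi: "absF \<pi> = inverse q"
  using residue_card_props(1)[OF unif] by (simp add: q_def inverse_eq_divide)

lemma pi_nz: "\<pi> \<noteq> 0"
  using unif by (simp add: uniformizer_def)

lemma absF_pi_powi: "absF (\<pi> powi k) = q powi (- k)"
  by (simp add: absF_powi absF_pi power_int_minus power_int_inverse)

lemma absF_lt_1_le: "absF x \<le> inverse q" if "absF x < 1" for x :: 'f
proof -
  have "x \<in> (*) \<pi> ` OF" using unif that by (auto simp: uniformizer_def)
  then show ?thesis
    using q_pos by (auto simp: absF_mult absF_pi OF_iff)
qed

lemma absF_eq_powi:
  fixes x :: 'f
  assumes "x \<noteq> 0"
  obtains k where "absF x = q powi (- k)"
proof -
  \<comment> \<open>Rounding up places the absolute value of \<open>x / \<pi> powi k\<close> above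
    1/q and at most 1. No absolute value lies strictly between 1/q and 1, so it is 1.\<close>
  define k where "k = - \<lceil>log q (absF x)\<rceil>"
  have pos: "absF x > 0" using assms by simp
  have le: "log q (absF x) \<le> of_int (- k)" and gt: "of_int (- k) < log q (absF x) + 1"
    unfolding k_def by linarith+
  have 1: "absF x \<le> q powi (- k)"
    using le pos q_pos q_gt_1 powr_real_of_int'[of q "- k"] by (simp add: log_le_iff)
  have 2: "q powi (- k) < q * absF x"
  proof -
    have "q powr of_int (- k) < q powr (log q (absF x) + 1)" using gt q_gt_1 by simp
    also have "\<dots> = q * absF x" using pos q_gt_1 by (simp add: powr_add)
    finally show ?thesis using powr_real_of_int'[of q "- k"] q_pos by simp
  qed
  have eq: "absF (x / \<pi> powi k) = absF x / q powi (- k)"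
    by (simp add: absF_divide absF_pi_powi)
  have pow: "0 < q powi (- k)" using q_pos by simp
  have "inverse q < absF x / q powi (- k)"
    using 2 pow q_pos by (simp add: pos_less_divide_eq inverse_eq_divide pos_divide_less_eq mult.commute[of q])
  then have "\<not> absF x / q powi (- k) < 1"
    using absF_lt_1_le[of "x / \<pi> powi k"] unfolding eq by linarith
  then have "absF x = q powi (- k)" using 1 pow by (simp only: divide_less_eq_1_pos not_less)
  then show ?thesis using that by blast
qed

lemma ex_small:
  assumes "0 < c"
  obtains N :: 'f where "N \<noteq> 0" "absF N < c"
proof -
  obtain n where n: "inverse q ^ n < c"
    using real_arch_pow_inv[OF assms, of "inverse q"] q_gt_1 by (auto simp: inverse_less_1_iff)
  show ?thesis using n pi_nz by (intro that[of "\<pi> ^ n"]) (auto simp: absF_power absF_pi)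
qed

section \<open>Representatives modulo powers of the maximal ideal\<close>

lemma residue_reps:
  obtains R :: "'f set" where "finite R" "R \<subseteq> OF" "real (card R) = q"
    "\<And>x. x \<in> OF \<Longrightarrow> \<exists>!r. r \<in> R \<and> absF (x - r) < 1"
proof -
  define E :: "('f \<times> 'f) set" where "E = {(x, y). x \<in> OF \<and> y \<in> OF \<and> absF (x - y) < 1}"
  have tr: "absF (x - z) < 1" if "absF (x - y) < 1" "absF (y - z) < 1" for x y z :: 'f
    using that absF_add_le[of "x - y" "y - z"] by simp
  have equiv: "equiv OF E"
    by (rule equivI) (auto simp: E_def refl_on_def sym_def trans_def absF_minus_commute intro: tr)
  have card: "real (card (OF // E)) = q"
    by (simp add: q_def residue_card_def residue_field_def E_def)
  have fin: "finite (OF // E)" using card q_gt_1 by (auto intro: card_ge_0_finite)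
  define g where "g X = (SOME x. x \<in> X)" for X :: "'f set"
  have g: "g X \<in> X" if "X \<in> OF // E" for X
    using in_quotient_imp_non_empty[OF equiv that] by (simp add: g_def some_in_eq)
  have g': "g X \<in> OF" if "X \<in> OF // E" for X
    using g[OF that] in_quotient_imp_subset[OF equiv that] by auto
  have inj: "X = Y" if "X \<in> OF // E" "Y \<in> OF // E" "(g X, g Y) \<in> E" for X Y
    using quotient_eq_iff[OF equiv that(1,2) g g] that by simp
  have refl: "(g X, g X) \<in> E" if "X \<in> OF // E" for X using g'[OF that] by (simp add: E_def)
  show ?thesis
  proof (rule that[of "g ` (OF // E)"])
    show "finite (g ` (OF // E))" "g ` (OF // E) \<subseteq> OF" using fin g' by auto
    have "inj_on g (OF // E)" using inj refl by (metis inj_onI)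
    then show "real (card (g ` (OF // E))) = q" using card by (simp add: card_image)
    fix x :: 'f assume x: "x \<in> OF"
    let ?X = "E `` {x}"
    have X: "?X \<in> OF // E" using x by (rule quotientI)
    show "\<exists>!r. r \<in> g ` (OF // E) \<and> absF (x - r) < 1"
    proof (rule ex1I[of _ "g ?X"])
      show "g ?X \<in> g ` (OF // E) \<and> absF (x - g ?X) < 1" using g[OF X] X by (auto simp: E_def)
      fix r assume r: "r \<in> g ` (OF // E) \<and> absF (x - r) < 1"
      then obtain Y where Y: "Y \<in> OF // E" "r = g Y" by auto
      have "(g ?X, g Y) \<in> E"
        using tr[of "g ?X" x "g Y"] g[OF X] r Y g' X by (auto simp: E_def absF_minus_commute)
      then show "r = g ?X" using inj X Y by blast
    qed
  qed
qed

lemma power_reps: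
  "\<exists>R::'f set. finite R \<and> R \<subseteq> OF \<and> real (card R) = q ^ n \<and>
    (\<forall>x\<in>OF. \<exists>!r. r \<in> R \<and> absF (x - r) \<le> inverse q ^ n)"
proof (induction n)
  case 0
  have "\<forall>x\<in>OF. \<exists>!r. r \<in> {0::'f} \<and> absF (x - r) \<le> 1" by (auto simp: OF_iff)
  then show ?case by (intro exI[of _ "{0}"]) (auto simp: OF_iff)
next
  case (Suc n)
  then obtain R :: "'f set" where R: "finite R" "R \<subseteq> OF" "real (card R) = q ^ n"
    "\<And>x. x \<in> OF \<Longrightarrow> \<exists>!r. r \<in> R \<and> absF (x - r) \<le> inverse q ^ n" by auto
  obtain S :: "'f set" where S: "finite S" "S \<subseteq> OF" "real (card S) = q"
    "\<And>x. x \<in> OF \<Longrightarrow> \<exists>!r. r \<in> S \<and> absF (x - r) < 1" using residue_reps by blast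
  \<comment> \<open>Digit expansion: \<open>s\<close> is the residue class and \<open>r\<close>
    represents the remaining quotient modulo the n-th power.\<close>
  let ?g = "\<lambda>(s, r). s + \<pi> * r"
  have mul: "absF (\<pi> * x) = absF x / q" for x by (simp add: absF_mult absF_pi divide_inverse)
  have small: "absF (\<pi> * x) < 1" if "x \<in> OF" for x
    using that q_gt_1 q_pos by (simp add: mul OF_iff)
  \<comment> \<open>Stated for congruent rather than equal values, so that it yields both the
    injectivity of \<open>?g\<close> and the uniqueness of representatives.\<close>
  have uniq: "s = s' \<and> r = r'"
    if sr: "s \<in> S" "s' \<in> S" "r \<in> R" "r' \<in> R" and le: "absF (s + \<pi> * r - (s' + \<pi> * r')) \<le> inverse q ^ Suc n"
    for s s' r r'
  proof -
    have "inverse q ^ Suc n < 1" using q_gt_1 by (intro power_Suc_less_one) (auto simp: inverse_less_1_iff)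
    then have "absF (s + \<pi> * r - (s' + \<pi> * r')) < 1" using le by simp
    moreover have "r \<in> OF" "r' \<in> OF" using sr R(2) by blast+
    then have "r - r' \<in> OF" by (simp add: OF_iff absF_diff_leI)
    then have "absF (\<pi> * (r - r')) < 1" by (rule small)
    ultimately have "absF (s - s') < 1"
      using absF_diff_le[of "s + \<pi> * r - (s' + \<pi> * r')" "\<pi> * (r - r')"] by (simp add: algebra_simps)
    moreover have "absF (s - s) < 1" by simp
    ultimately have s: "s = s'" using S(2,4) sr by blast
    then have "absF (\<pi> * (r - r')) \<le> inverse q ^ Suc n" using le by (simp add: algebra_simps)
    then have "absF (r - r') \<le> inverse q ^ n"
      unfolding mul using q_pos by (simp add: field_simps)
    moreover have "absF (r - r) \<le> inverse q ^ n" using q_pos by simp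
    ultimately have "r = r'" using R(2,4) sr by blast
    with s show ?thesis by simp
  qed
  have inj: "inj_on ?g (S \<times> R)"
  proof (rule inj_onI, clarify)
    fix s r s' r' assume "s \<in> S" "r \<in> R" "s' \<in> S" "r' \<in> R" "s + \<pi> * r = s' + \<pi> * r'"
    then show "s = s' \<and> r = r'" using uniq[of s s' r r'] q_pos by simp
  qed
  show ?case
  proof (intro exI[of _ "?g ` (S \<times> R)"] conjI ballI)
    show "finite (?g ` (S \<times> R))" using R S by auto
    show "?g ` (S \<times> R) \<subseteq> OF"
    proof clarify
      fix s r assume "s \<in> S" "r \<in> R"
      then have "s \<in> OF" "r \<in> OF" using R(2) S(2) by blast+
      then show "s + \<pi> * r \<in> OF"
        using small[of r] absF_add_leI[of s 1 "\<pi> * r"] by (simp add: OF_iff)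
    qed
    show "real (card (?g ` (S \<times> R))) = q ^ Suc n"
      using R S by (simp add: card_image[OF inj] card_cartesian_product)
    fix x :: 'f assume x: "x \<in> OF"
    obtain s where s: "s \<in> S" "absF (x - s) < 1" using S(4)[OF x] by blast
    then have "x - s \<in> (*) \<pi> ` OF" using unif by (auto simp: uniformizer_def)
    then obtain y where y: "y \<in> OF" "x - s = \<pi> * y" by auto
    obtain r where r: "r \<in> R" "absF (y - r) \<le> inverse q ^ n" using R(4)[OF y(1)] by blast
    have eq: "x - (s + \<pi> * r) = \<pi> * (y - r)" using y(2) by (simp add: algebra_simps)
    have le: "absF (x - (s + \<pi> * r)) \<le> inverse q ^ Suc n"
      unfolding eq mul using r(2) q_pos by (simp add: field_simps)
    show "\<exists>!r. r \<in> ?g ` (S \<times> R) \<and> absF (x - r) \<le> inverse q ^ Suc n"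
    proof (rule ex1I[of _ "s + \<pi> * r"])
      show "s + \<pi> * r \<in> ?g ` (S \<times> R) \<and> absF (x - (s + \<pi> * r)) \<le> inverse q ^ Suc n"
        using s(1) r(1) le by (auto intro!: image_eqI[of _ _ "(s, r)"])
      fix t assume t: "t \<in> ?g ` (S \<times> R) \<and> absF (x - t) \<le> inverse q ^ Suc n"
      then obtain s' r' where t': "s' \<in> S" "r' \<in> R" "t = s' + \<pi> * r'" by auto
      have "absF (s' + \<pi> * r' - (s + \<pi> * r)) \<le> inverse q ^ Suc n"
        using absF_diff_leI[OF le conjunct2[OF t]] t' by (simp add: algebra_simps)
      then show "t = s + \<pi> * r" using uniq t' s(1) r(1) by blast
    qed
  qed
qed

lemma reps:
  fixes c :: 'f
  assumes "c \<noteq> 0" "absF c \<le> 1"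
  obtains R :: "'f set" where "finite R" "R \<subseteq> OF" "real (card R) = inverse (absF c)"
    "\<And>x. x \<in> OF \<Longrightarrow> \<exists>!r. r \<in> R \<and> absF (x - r) \<le> absF c"
proof -
  obtain k where k: "absF c = q powi (- k)" using absF_eq_powi assms(1) by blast
  have "0 \<le> k"
  proof (rule ccontr)
    assume "\<not> 0 \<le> k"
    then have "1 < q powi (- k)" using q_gt_1 by (intro one_less_power_int) auto
    then show False using k assms by simp
  qed
  then have "absF c = inverse q ^ nat k" "inverse (absF c) = q ^ nat k"
    by (simp_all add: k power_int_minus power_int_def power_inverse)
  then show ?thesis using power_reps[of "nat k"] that by auto
qed

lemma transversal_OF:
  fixes c :: 'f
  assumes "c \<noteq> 0" "absF c \<le> 1"
  obtains R :: "'f set" where "transversal OF {x. absF x \<le> absF c} R"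
proof -
  obtain R :: "'f set" where R: "finite R" "R \<subseteq> OF" "real (card R) = inverse (absF c)"
    "\<And>x. x \<in> OF \<Longrightarrow> \<exists>!r. r \<in> R \<and> absF (x - r) \<le> absF c" using reps assms by blast
  have "transversal OF {x. absF x \<le> absF c} R"
    by unfold_locales (use R assms(2) in \<open>auto simp: OF_iff intro: absF_diff_leI\<close>)
  then show ?thesis using that by blast
qed

text \<open>The points stay distinct modulo \<open>c\<close> after multiplication by
  \<open>a\<close>: one point if \<open>a\<close> is divisible by \<open>c\<close>, representatives
  modulo \<open>c / a\<close> otherwise. The maximum in the bound merges both cases.\<close>

lemma separated_subset:
  fixes c :: 'f
  assumes "c \<noteq> 0"
  obtains R :: "'f set" where "finite R" "R \<subseteq> OF" "max (absF a) (absF c) / absF c \<le> card R"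
    "\<And>x y. x \<in> R \<Longrightarrow> y \<in> R \<Longrightarrow> absF (a * (x - y)) \<le> absF c \<Longrightarrow> x = y"
proof (cases "absF a \<le> absF c")
  case True
  then show ?thesis using assms by (intro that[of "{0}"]) (auto simp: OF_iff max_def)
next
  case False
  then have a: "a \<noteq> 0" by auto
  have a': "absF (c / a) \<le> 1" using False a by (simp add: absF_divide divide_le_eq_1)
  obtain R :: "'f set" where R: "finite R" "R \<subseteq> OF" "real (card R) = inverse (absF (c / a))"
    "\<And>x. x \<in> OF \<Longrightarrow> \<exists>!r. r \<in> R \<and> absF (x - r) \<le> absF (c / a)"
    using reps[of "c / a"] a a' assms by auto
  show ?thesis
  proof (rule that[OF R(1,2)])
    show "max (absF a) (absF c) / absF c \<le> card R"
      using False R(3) by (simp add: absF_divide)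
    fix x y assume xy: "x \<in> R" "y \<in> R" "absF (a * (x - y)) \<le> absF c"
    then have "absF (x - y) * absF a \<le> absF c" by (simp only: absF_mult mult.commute)
    then have "absF (x - y) \<le> absF (c / a)" using a by (simp add: absF_divide pos_le_divide_eq)
    moreover have "absF (x - x) \<le> absF (c / a)" by simp
    ultimately show "x = y" using R(2,4) xy by blast
  qed
qed

end

text \<open>Later arguments use the parity of the residue characteristic only through this
  equation.\<close>

lemma absF_2:
  assumes "odd (residue_char TYPE('f::nonarch_local_field))"
  shows "absF (2::'f) = 1"
proof (rule ccontr)
  assume "absF (2::'f) \<noteq> 1"
  then have less: "absF (2::'f) < 1" using absF_add_leI[of "1::'f" 1 1] by simp
  have "residue_char TYPE('f) = 2"
    unfolding residue_char_def
  proof (rule Least_equality)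
    show "0 < (2::nat) \<and> absF (of_nat 2 :: 'f) < 1" using less by simp
    fix k :: nat assume k: "0 < k \<and> absF (of_nat k :: 'f) < 1"
    then have "k \<noteq> 1" by auto
    with k show "2 \<le> k" by linarith
  qed
  with assms show False by simp
qed

section \<open>Integral matrices\<close>

lemma adjugate_nth[simp]:
  "adjugate A $ 1 $ 1 = A $ 2 $ 2" "adjugate A $ 1 $ 2 = - A $ 1 $ 2"
  "adjugate A $ 2 $ 1 = - A $ 2 $ 1" "adjugate A $ 2 $ 2 = A $ 1 $ 1"
  by (simp_all add: adjugate_def)

lemma scaleM_nth[simp]: "(c *m A) $ i $ j = c * A $ i $ j"
  by (simp add: scaleM_def)

lemma matrix_mult_nth_2: "(A ** B) $ i $ j = A$i$1 * B$1$j + A$i$2 * B$2$j"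
  for A B :: "'a::comm_ring_1^2^2"
  by (simp add: matrix_matrix_mult_def sum_2)

lemma matrix_2_eq_iff:
  "A = B \<longleftrightarrow> A$1$1 = B$1$1 \<and> A$1$2 = B$1$2 \<and> A$2$1 = B$2$1 \<and> A$2$2 = B$2$2"
  for A B :: "'a^2^2"
  by (auto simp: vec_eq_iff forall_2)

lemmas matrix_2_simps = matrix_2_eq_iff matrix_mult_nth_2 det_2 mat_def

lemma trace_2: "trace A = A$1$1 + A$2$2" for A :: "'a::comm_ring_1^2^2"
  by (simp add: trace_def sum_2)

lemma trace_scaleM: "trace (c *m A) = c * trace A" for A :: "'a::comm_ring_1^2^2"
  by (simp add: trace_2 algebra_simps)

lemma scaleM_mult_left: "(c *m A) ** B = c *m (A ** B)"
  and scaleM_mult_right: "A ** (c *m B) = c *m (A ** B)"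
  and scaleM_assoc: "a *m b *m A = (a * b) *m A"
  and scaleM_add: "c *m (A + B) = c *m A + c *m B"
  and scaleM_diff: "c *m (A - B) = c *m A - c *m B"
  and scaleM_zero: "c *m 0 = 0"
  and scaleM_one: "1 *m A = A"
  and mat_scaleM: "mat c ** A = c *m A" "A ** mat c = c *m A"
  for A B :: "'a::comm_ring_1^2^2"
  by (simp_all add: matrix_2_simps algebra_simps)

lemma adjugate_mult: "adjugate A ** A = mat (det A)" "A ** adjugate A = mat (det A)"
  by (simp_all add: matrix_2_simps algebra_simps)

lemma matrix_mult_add_left: "(A + B) ** C = A ** C + B ** C"
  and matrix_mult_add_right: "C ** (A + B) = C ** A + C ** B"
  for A B C :: "'a::comm_ring_1^2^2"
  by (simp_all add: matrix_2_simps algebra_simps)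

lemma matrix_mult_diff_left: "(A - B) ** C = A ** C - B ** C"
  and matrix_mult_diff_right: "C ** (A - B) = C ** A - C ** B"
  for A B C :: "'a::comm_ring_1^2^2"
  by (simp_all add: matrix_2_simps algebra_simps)

lemma matrix_inv_unique_2:
  fixes A :: "'a::field^2^2"
  assumes C: "A ** C = mat 1" "C ** A = mat 1"
  shows "matrix_inv A = C"
proof -
  have "A ** matrix_inv A = mat 1 \<and> matrix_inv A ** A = mat 1"
    unfolding matrix_inv_def
    by (rule someI[of "\<lambda>B. A ** B = mat 1 \<and> B ** A = mat 1", OF conjI[OF C]])
  then have *: "matrix_inv A ** A = mat 1" ..
  have "matrix_inv A ** (A ** C) = mat 1 ** C"
    unfolding *[symmetric] by (rule matrix_mul_assoc)
  then show ?thesis unfolding C(1) matrix_mul_rid matrix_mul_lid .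
qed

lemma matrix_inv_2:
  fixes A :: "'a::field^2^2"
  assumes "invertible A"
  shows "matrix_inv A = inverse (det A) *m adjugate A"
proof (rule matrix_inv_unique_2)
  have "det A \<noteq> 0" using assms invertible_det_nz by blast
  then have *: "inverse (det A) *m mat (det A) = mat 1" by (simp add: matrix_2_eq_iff mat_def)
  show "A ** (inverse (det A) *m adjugate A) = mat 1"
    unfolding scaleM_mult_right adjugate_mult by (rule *)
  show "(inverse (det A) *m adjugate A) ** A = mat 1"
    unfolding scaleM_mult_left adjugate_mult by (rule *)
qed

text \<open>For \<open>c = absF x\<close> with \<open>x\<close> nonzero this is the lattice x O_D. A
  real radius lets congruences and norm estimates share one calculus.\<close>

definition entries_le :: "real \<Rightarrow> ('f::nonarch_local_field^2^2) \<Rightarrow> bool"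
  where "entries_le c A \<longleftrightarrow> (\<forall>i j. absF (A$i$j) \<le> c)"

lemma OD_iff: "A \<in> OD \<longleftrightarrow> entries_le 1 A"
  by (simp add: OD_def OF_def entries_le_def)

lemma entries_le_2: "entries_le c A \<longleftrightarrow> absF (A$1$1) \<le> c \<and> absF (A$1$2) \<le> c \<and>
    absF (A$2$1) \<le> c \<and> absF (A$2$2) \<le> c"
  by (auto simp: entries_le_def forall_2)

lemma entries_le_mono: "entries_le c A \<Longrightarrow> c \<le> d \<Longrightarrow> entries_le d A"
  by (meson entries_le_def order_trans)

lemma entries_le_0: "0 \<le> c \<Longrightarrow> entries_le c 0"
  by (simp add: entries_le_def)

lemma entries_le_add: "entries_le c A \<Longrightarrow> entries_le c B \<Longrightarrow> entries_le c (A + B)"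
  by (simp add: entries_le_def absF_add_leI)

lemma entries_le_diff: "entries_le c A \<Longrightarrow> entries_le c B \<Longrightarrow> entries_le c (A - B)"
  by (simp add: entries_le_def absF_diff_leI)

lemma entries_le_minus: "entries_le c (- A) \<longleftrightarrow> entries_le c A"
  by (simp add: entries_le_def)

lemma entries_le_mult:
  assumes "entries_le c A" "entries_le d B"
  shows "entries_le (c * d) (A ** B)"
proof -
  have "0 \<le> c" using assms(1) absF_nonneg order_trans unfolding entries_le_def by blast
  then have "absF (A$i$k * B$k$j) \<le> c * d" for i j k
    using assms by (auto simp: absF_mult entries_le_def intro!: mult_mono)
  then show ?thesis by (simp add: entries_le_def matrix_mult_nth_2 absF_add_leI)
qed

lemma entries_le_scaleM: "entries_le c A \<Longrightarrow> entries_le (absF x * c) (x *m A)"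
  by (simp add: entries_le_def absF_mult mult_left_mono)

lemma entries_le_scaleM_iff: "x \<noteq> 0 \<Longrightarrow> entries_le (absF x * c) (x *m A) \<longleftrightarrow> entries_le c A"
  by (simp add: entries_le_def absF_mult)

lemma entries_le_adjugate[simp]: "entries_le c (adjugate A) \<longleftrightarrow> entries_le c A"
  by (auto simp: entries_le_2)

lemma OD_zero: "0 \<in> OD" and OD_add: "A \<in> OD \<Longrightarrow> B \<in> OD \<Longrightarrow> A + B \<in> OD"
  and OD_diff: "A \<in> OD \<Longrightarrow> B \<in> OD \<Longrightarrow> A - B \<in> OD"
  and OD_adjugate: "adjugate A \<in> OD \<longleftrightarrow> A \<in> OD"
  by (simp_all add: OD_iff entries_le_0 entries_le_add entries_le_diff)

lemma OD_mult: "A \<in> OD \<Longrightarrow> B \<in> OD \<Longrightarrow> A ** B \<in> OD"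
  using entries_le_mult[of 1 A 1 B] by (simp add: OD_iff)

lemma OD_scaleM: "x \<in> OF \<Longrightarrow> A \<in> OD \<Longrightarrow> x *m A \<in> OD"
  using entries_le_mono[OF entries_le_scaleM[of 1 A x], of 1] by (simp add: OD_iff OF_iff)

lemma OF_mult: "x \<in> OF \<Longrightarrow> y \<in> OF \<Longrightarrow> x * y \<in> OF"
  and OF_add: "x \<in> OF \<Longrightarrow> y \<in> OF \<Longrightarrow> x + y \<in> OF"
  and OF_diff: "x \<in> OF \<Longrightarrow> y \<in> OF \<Longrightarrow> x - y \<in> OF"
  and OF_minus: "x \<in> OF \<Longrightarrow> - x \<in> OF"
  and OF_zero: "0 \<in> OF" and OF_one: "1 \<in> OF"
  by (auto simp: OF_iff absF_mult mult_le_one intro: absF_add_leI absF_diff_leI)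

lemma OF_sum: "(\<And>i. i \<in> I \<Longrightarrow> f i \<in> OF) \<Longrightarrow> sum f I \<in> OF"
  by (simp add: OF_iff absF_sum_le)

lemma trace_OD: "A \<in> OD \<Longrightarrow> trace A \<in> OF"
  by (simp add: trace_2 OD_def OF_add)

lemma det_OD: "A \<in> OD \<Longrightarrow> det A \<in> OF"
  by (simp add: det_2 OD_def OF_diff OF_mult)

lemma scaleM_OD_iff: "x \<noteq> 0 \<Longrightarrow> A \<in> (*m) x ` OD \<longleftrightarrow> entries_le (absF x) A"
proof
  assume "A \<in> (*m) x ` OD"
  then show "entries_le (absF x) A" using entries_le_scaleM[of 1 _ x] by (auto simp: OD_iff)
next
  assume x: "x \<noteq> 0" and le: "entries_le (absF x) A"
  have A: "x *m (inverse x *m A) = A" using x by (simp add: scaleM_assoc scaleM_one)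
  have "inverse x *m A \<in> OD"
    using le x A entries_le_scaleM_iff[OF x, of 1 "inverse x *m A"] by (simp add: OD_iff)
  then show "A \<in> (*m) x ` OD" using A by (metis imageI)
qed

context local_field
begin

text \<open>The largest entry has absolute value \<open>q powi (- k)\<close> for some
  \<open>k\<close>, and \<open>A\<close> lies in the e-th power lattice exactly for
  \<open>e \<le> k\<close>; hence the \<open>GREATEST\<close> in \<open>valD\<close> exists and is
  \<open>k\<close>.\<close>

lemma normD_eq:
  "normD \<pi> A = max (max (absF (A$1$1)) (absF (A$1$2))) (max (absF (A$2$1)) (absF (A$2$2)))"
  (is "_ = ?m")
proof (cases "A = 0")
  case False
  define m where "m = ?m"
  have m_le: "m \<le> c \<longleftrightarrow> entries_le c A" for c by (simp add: m_def entries_le_2)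
  have "m \<in> range (absF :: 'f \<Rightarrow> real)" by (auto simp: m_def max_def)
  then obtain x :: 'f where x: "m = absF x" by blast
  have "x \<noteq> 0"
  proof
    assume "x = 0"
    then have "entries_le 0 A" using m_le[of 0] x by simp
    then show False using False by (simp add: entries_le_2 matrix_2_eq_iff)
  qed
  then obtain k where k: "m = q powi (- k)" using absF_eq_powi x by metis
  have iff: "A \<in> (*m) (\<pi> powi e) ` OD \<longleftrightarrow> e \<le> k" for e
  proof -
    have "\<pi> powi e \<noteq> 0" using pi_nz by simp
    from scaleM_OD_iff[OF this] have "A \<in> (*m) (\<pi> powi e) ` OD \<longleftrightarrow> q powi (- k) \<le> q powi (- e)"
      by (simp only: absF_pi_powi m_le[symmetric] k)
    then show ?thesis
      using power_int_increasing[of "- k" "- e" q] power_int_strict_increasing[of "- e" "- k" q] q_gt_1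
      by linarith
  qed
  have "valD \<pi> A = k"
    unfolding valD_def by (rule Greatest_equality) (simp_all only: iff)
  then have "normD \<pi> A = q powi (- k)" unfolding normD_def q_def using False by simp
  then show ?thesis using k unfolding m_def by simp
qed (simp add: normD_def)

lemma normD_le_iff: "normD \<pi> A \<le> c \<longleftrightarrow> entries_le c A"
  by (auto simp: normD_eq entries_le_2)

lemma entries_le_normD: "entries_le (normD \<pi> A) A"
  using normD_le_iff by blast

lemma normD_scaleM: "normD \<pi> (x *m A) = absF x * normD \<pi> A"
  by (simp add: normD_eq absF_mult max_mult_distrib_left)

lemma normDn_le_iff: "normDn \<pi> Y \<le> c \<longleftrightarrow> (\<forall>i. entries_le c (Y$i))"
  by (simp add: normDn_def normD_le_iff)

lemma normD_eq_absF_powi: "A \<noteq> 0 \<Longrightarrow> normD \<pi> A = absF (\<pi> powi valD \<pi> A)"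
  by (simp add: normD_def absF_pi_powi q_def)

end

section \<open>The anticommutator\<close>

context local_field
begin

text \<open>\<open>g\<close> parametrises a three-dimensional family additively. In the last
  assumption \<open>x\<close>, \<open>y\<close>, \<open>z\<close> are differences of elements of
  three sets from \<open>separated_subset\<close>, which is what the implications ending in
  \<open>x = 0\<close> and the like encode. Each case of the kernel estimate then only has to choose
  a family and three weights.\<close>

lemma separated_matrices:
  fixes c a1 a2 a3 :: 'f and C :: "'f^2^2" and g :: "'f \<Rightarrow> 'f \<Rightarrow> 'f \<Rightarrow> 'f^2^2"
  assumes c: "c \<noteq> 0"
    and g_diff: "\<And>x y z x' y' z'. g x y z - g x' y' z' = g (x - x') (y - y') (z - z')"
    and g_OD: "\<And>x y z. x \<in> OF \<Longrightarrow> y \<in> OF \<Longrightarrow> z \<in> OF \<Longrightarrow> g x y z \<in> OD"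
    and g: "\<And>x y z. (absF (a1 * x) \<le> absF c \<Longrightarrow> x = 0) \<Longrightarrow> (absF (a2 * y) \<le> absF c \<Longrightarrow> y = 0) \<Longrightarrow>
      (absF (a3 * z) \<le> absF c \<Longrightarrow> z = 0) \<Longrightarrow>
      entries_le (absF c) (C ** g x y z + g x y z ** C) \<Longrightarrow> x = 0 \<and> y = 0 \<and> z = 0"
  obtains T where "finite T" "T \<subseteq> OD"
    "max (absF a1) (absF c) / absF c * (max (absF a2) (absF c) / absF c) *
      (max (absF a3) (absF c) / absF c) \<le> card T"
    "\<And>X Y. X \<in> T \<Longrightarrow> Y \<in> T \<Longrightarrow> entries_le (absF c) (C ** (X - Y) + (X - Y) ** C) \<Longrightarrow> X = Y"
proof -
  obtain R1 :: "'f set" where R1: "finite R1" "R1 \<subseteq> OF" "max (absF a1) (absF c) / absF c \<le> card R1"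
    "\<And>x y. x \<in> R1 \<Longrightarrow> y \<in> R1 \<Longrightarrow> absF (a1 * (x - y)) \<le> absF c \<Longrightarrow> x = y"
    using separated_subset[OF c] by blast
  obtain R2 :: "'f set" where R2: "finite R2" "R2 \<subseteq> OF" "max (absF a2) (absF c) / absF c \<le> card R2"
    "\<And>x y. x \<in> R2 \<Longrightarrow> y \<in> R2 \<Longrightarrow> absF (a2 * (x - y)) \<le> absF c \<Longrightarrow> x = y"
    using separated_subset[OF c] by blast
  obtain R3 :: "'f set" where R3: "finite R3" "R3 \<subseteq> OF" "max (absF a3) (absF c) / absF c \<le> card R3"
    "\<And>x y. x \<in> R3 \<Longrightarrow> y \<in> R3 \<Longrightarrow> absF (a3 * (x - y)) \<le> absF c \<Longrightarrow> x = y"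
    using separated_subset[OF c] by blast
  define h where "h = (\<lambda>(x, y, z). g x y z)"
  have sep: "p = p'"
    if pp: "p \<in> R1 \<times> R2 \<times> R3" "p' \<in> R1 \<times> R2 \<times> R3"
      "entries_le (absF c) (C ** (h p - h p') + (h p - h p') ** C)" for p p'
  proof -
    obtain x y z where p: "p = (x, y, z)" "x \<in> R1" "y \<in> R2" "z \<in> R3" using pp(1) by (cases p) auto
    obtain x' y' z' where p': "p' = (x', y', z')" "x' \<in> R1" "y' \<in> R2" "z' \<in> R3"
      using pp(2) by (cases p') auto
    have h: "h p - h p' = g (x - x') (y - y') (z - z')" by (simp add: h_def p p' g_diff)
    have "x - x' = 0 \<and> y - y' = 0 \<and> z - z' = 0"
      using R1(4)[OF p(2) p'(2)] R2(4)[OF p(3) p'(3)] R3(4)[OF p(4) p'(4)] pp(3)[unfolded h]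
      by (intro g) simp_all
    then show ?thesis by (simp add: p p')
  qed
  have inj: "inj_on h (R1 \<times> R2 \<times> R3)"
  proof (rule inj_onI)
    fix p p' assume *: "p \<in> R1 \<times> R2 \<times> R3" "p' \<in> R1 \<times> R2 \<times> R3" "h p = h p'"
    have "entries_le (absF c) (C ** (h p - h p') + (h p - h p') ** C)"
      using *(3) by (simp add: entries_le_2 matrix_mult_nth_2)
    then show "p = p'" using sep * by blast
  qed
  show ?thesis
  proof (rule that[of "h ` (R1 \<times> R2 \<times> R3)"])
    show "finite (h ` (R1 \<times> R2 \<times> R3))" using R1 R2 R3 by simp
    show "h ` (R1 \<times> R2 \<times> R3) \<subseteq> OD"
      using R1(2) R2(2) R3(2) by (auto simp: h_def subset_iff intro!: g_OD)
    have "card (h ` (R1 \<times> R2 \<times> R3)) = card R1 * card R2 * card R3"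
      by (simp add: card_image[OF inj] card_cartesian_product)
    moreover have "max (absF a1) (absF c) / absF c * (max (absF a2) (absF c) / absF c) *
      (max (absF a3) (absF c) / absF c) \<le> real (card R1) * card R2 * card R3"
      using c by (intro mult_mono R1 R2 R3) (auto simp: le_max_iff_disj)
    ultimately show "max (absF a1) (absF c) / absF c * (max (absF a2) (absF c) / absF c) *
      (max (absF a3) (absF c) / absF c) \<le> card (h ` (R1 \<times> R2 \<times> R3))" by simp
    fix X Y assume "X \<in> h ` (R1 \<times> R2 \<times> R3)" "Y \<in> h ` (R1 \<times> R2 \<times> R3)"
      "entries_le (absF c) (C ** (X - Y) + (X - Y) ** C)"
    then show "X = Y" using sep by blast
  qed
qed

lemma absF_mult_le: "absF u \<le> 1 \<Longrightarrow> absF x \<le> c \<Longrightarrow> absF (u * x) \<le> c" for u x :: 'f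
  using mult_mono[of "absF u" 1 "absF x" c] by (simp add: absF_mult)

text \<open>The kernel of \<open>X \<mapsto> CX + XC\<close> modulo \<open>c\<close> is bounded from above by exhibiting many integral
  matrices that are pairwise incongruent modulo that kernel.\<close>

lemma anticommutator_separated:
  fixes C :: "'f^2^2" and c :: 'f
  assumes two: "absF (2::'f) = 1" and c: "c \<noteq> 0"
  obtains T where "finite T" "T \<subseteq> OD"
    "(max (normD \<pi> C) (absF c) / absF c)\<^sup>2 * (max (absF (trace C)) (absF c) / absF c) \<le> card T"
    "\<And>X Y. X \<in> T \<Longrightarrow> Y \<in> T \<Longrightarrow> entries_le (absF c) (C ** (X - Y) + (X - Y) ** C) \<Longrightarrow> X = Y"
proof -
  let ?M = "normD \<pi> C"
  let ?P = "\<lambda>T. finite T \<and> T \<subseteq> OD \<and>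
    (max ?M (absF c) / absF c)\<^sup>2 * (max (absF (trace C)) (absF c) / absF c) \<le> card T \<and>
    (\<forall>X\<in>T. \<forall>Y\<in>T. entries_le (absF c) (C ** (X - Y) + (X - Y) ** C) \<longrightarrow> X = Y)"
  define a b d e t where defs: "a = C$1$1" "b = C$1$2" "d = C$2$1" "e = C$2$2" "t = a + e"
  have half: "absF (1 / 2 :: 'f) = 1" using two by (simp add: absF_divide)
  have tr: "trace C = t" by (simp add: trace_2 defs)
  have M: "?M = max (max (absF a) (absF b)) (max (absF d) (absF e))" by (simp add: normD_eq defs)
  have le: "absF a \<le> ?M" "absF b \<le> ?M" "absF d \<le> ?M" "absF e \<le> ?M" by (simp_all add: M)
  have t_le: "absF t \<le> ?M" unfolding defs(5) by (rule absF_add_leI) (auto simp: M)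
  have anti: "entries_le (absF c) (C ** X + X ** C) \<longleftrightarrow>
      absF (2 * a * X$1$1 + b * X$2$1 + d * X$1$2) \<le> absF c \<and>
      absF (b * (X$1$1 + X$2$2) + t * X$1$2) \<le> absF c \<and>
      absF (d * (X$1$1 + X$2$2) + t * X$2$1) \<le> absF c \<and>
      absF (2 * e * X$2$2 + b * X$2$1 + d * X$1$2) \<le> absF c" for X
    by (simp add: entries_le_2 matrix_mult_nth_2 defs algebra_simps)
  have "\<exists>T. ?P T"
  proof (cases "?M \<le> absF c")
    case True
    \<comment> \<open>Here both maxima equal \<open>absF c\<close>, so the required cardinality is
      1.\<close>
    then show ?thesis using c t_le by (intro exI[of _ "{0}"]) (simp add: tr OD_zero max_def)
  next
    case large: False
    then have M_pos: "0 < ?M" using absF_nonneg[of c] by linarith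
    \<comment> \<open>The position of a largest entry decides which coordinates of X are kept. If it
      occurs only on the diagonal and just once, the trace has full norm; if both diagonal entries
      attain it, they may cancel in the trace.\<close>
    consider (b) "?M = absF b" | (d) "?M = absF d"
      | (t) "absF t = ?M" "absF a = ?M \<or> absF e = ?M"
      | (ae) "absF a = ?M" "absF e = ?M" "absF b < ?M" "absF d < ?M"
    proof -
      have eq: "?M \<in> {absF a, absF b, absF d, absF e}" by (simp add: M max_def)
      show ?thesis
      proof (cases "?M = absF b \<or> ?M = absF d")
        case False
        then have *: "absF b < ?M" "absF d < ?M" "absF a = ?M \<or> absF e = ?M" using le eq by auto
        show ?thesis
        proof (cases "absF a = ?M \<and> absF e = ?M")
          case True then show ?thesis using * that(4) by blast
        next
          case False
          then have "absF t = ?M"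
            using *(3) le absF_add_eq[of e a] absF_add_eq[of a e] unfolding defs(5)
            by (auto simp: add.commute)
          then show ?thesis using * that(3) by blast
        qed
      qed (use that in blast)
    qed
    then show ?thesis
    proof cases
      case b
      then have b0: "b \<noteq> 0" using M_pos by auto
      have ab: "absF (a / b) \<le> 1" using b le b0 by (simp add: absF_divide)
      show ?thesis
      proof (rule separated_matrices[where c = c and C = C and ?a1.0 = b and ?a2.0 = b and ?a3.0 = t
            and g = "\<lambda>x z w. vector [vector [x, 0], vector [z, w]]"])
        show "c \<noteq> 0" by fact
        fix x z w assume sep: "absF (b * x) \<le> absF c \<Longrightarrow> x = 0" "absF (b * z) \<le> absF c \<Longrightarrow> z = 0"
          "absF (t * w) \<le> absF c \<Longrightarrow> w = 0"
          and "entries_le (absF c) (C ** vector [vector [x, 0], vector [z, w]] +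
            vector [vector [x, 0], vector [z, w]] ** C)"
        then have h: "absF (2 * a * x + b * z) \<le> absF c" "absF (b * (x + w)) \<le> absF c"
            "absF (2 * e * w + b * z) \<le> absF c" unfolding anti by simp_all
        \<comment> \<open>Subtracting the diagonal equations eliminates \<open>z\<close> and leaves
          \<open>2 * a * x - 2 * e * w\<close>; removing half of it from \<open>a * (x + w)\<close>
          leaves \<open>(a + e) * w\<close>.\<close>
        have "t * w = (a / b) * (b * (x + w)) - (1 / 2) * ((2 * a * x + b * z) - (2 * e * w + b * z))"
          using b0 by (simp add: defs(5) field_simps)
        also have "absF \<dots> \<le> absF c"
          by (intro absF_diff_leI absF_mult_le[OF ab] absF_mult_le[OF eq_refl[OF half]] h)
        finally have w: "w = 0" by (rule sep)
        then have x: "x = 0" using h(2) sep(1) by simp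
        then have "z = 0" using h(1) sep(2) by simp
        then show "x = 0 \<and> z = 0 \<and> w = 0" using w x by simp
      qed (use b in \<open>auto simp: matrix_2_eq_iff OD_def forall_2 OF_iff tr power2_eq_square\<close>)
    next
      \<comment> \<open>The transpose of the previous case: transposition commutes with the
        anticommutator and exchanges \<open>b\<close> and \<open>d\<close>.\<close>
      case d
      then have d0: "d \<noteq> 0" using M_pos by auto
      have ad: "absF (a / d) \<le> 1" using d le d0 by (simp add: absF_divide)
      show ?thesis
      proof (rule separated_matrices[where c = c and C = C and ?a1.0 = d and ?a2.0 = d and ?a3.0 = t
            and g = "\<lambda>x z w. vector [vector [x, z], vector [0, w]]"])
        show "c \<noteq> 0" by fact
        fix x z w assume sep: "absF (d * x) \<le> absF c \<Longrightarrow> x = 0" "absF (d * z) \<le> absF c \<Longrightarrow> z = 0"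
          "absF (t * w) \<le> absF c \<Longrightarrow> w = 0"
          and "entries_le (absF c) (C ** vector [vector [x, z], vector [0, w]] +
            vector [vector [x, z], vector [0, w]] ** C)"
        then have h: "absF (2 * a * x + d * z) \<le> absF c" "absF (d * (x + w)) \<le> absF c"
            "absF (2 * e * w + d * z) \<le> absF c" unfolding anti by simp_all
        have "t * w = (a / d) * (d * (x + w)) - (1 / 2) * ((2 * a * x + d * z) - (2 * e * w + d * z))"
          using d0 by (simp add: defs(5) field_simps)
        also have "absF \<dots> \<le> absF c"
          by (intro absF_diff_leI absF_mult_le[OF ad] absF_mult_le[OF eq_refl[OF half]] h)
        finally have w: "w = 0" by (rule sep)
        then have x: "x = 0" using h(2) sep(1) by simp
        then have "z = 0" using h(1) sep(2) by simp
        then show "x = 0 \<and> z = 0 \<and> w = 0" using w x by simp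
      qed (use d in \<open>auto simp: matrix_2_eq_iff OD_def forall_2 OF_iff tr power2_eq_square\<close>)
    next
      \<comment> \<open>The trace has full norm, so the weights \<open>a\<close> or
        \<open>e\<close>, \<open>t\<close>, \<open>t\<close> have the right product. Setting the
        other diagonal entry of X to 0 turns its equation into a bound for
        \<open>b * z + d * y\<close>, which then cancels from the remaining diagonal
        equation.\<close>
      case t
      then consider (a) "absF a = ?M" | (e) "absF e = ?M" by blast
      then show ?thesis
      proof cases
        case a
        show ?thesis
        proof (rule separated_matrices[where c = c and C = C and ?a1.0 = a and ?a2.0 = t and ?a3.0 = t
              and g = "\<lambda>x y z. vector [vector [x, y], vector [z, 0]]"])
          show "c \<noteq> 0" by fact
          fix x y z assume sep: "absF (a * x) \<le> absF c \<Longrightarrow> x = 0" "absF (t * y) \<le> absF c \<Longrightarrow> y = 0"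
            "absF (t * z) \<le> absF c \<Longrightarrow> z = 0"
            and "entries_le (absF c) (C ** vector [vector [x, y], vector [z, 0]] +
              vector [vector [x, y], vector [z, 0]] ** C)"
          then have h: "absF (2 * a * x + b * z + d * y) \<le> absF c" "absF (b * x + t * y) \<le> absF c"
              "absF (d * x + t * z) \<le> absF c" "absF (b * z + d * y) \<le> absF c"
            unfolding anti by simp_all
          have "a * x = (1 / 2) * ((2 * a * x + b * z + d * y) - (b * z + d * y))" by simp
          also have "absF \<dots> \<le> absF c" by (intro absF_diff_leI absF_mult_le[OF eq_refl[OF half]] h)
          finally have x: "x = 0" by (rule sep)
          then show "x = 0 \<and> y = 0 \<and> z = 0" using h(2,3) sep(2,3) by simp
        qed (use t a in \<open>auto simp: matrix_2_eq_iff OD_def forall_2 OF_iff tr power2_eq_square\<close>)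
      next
        case e
        show ?thesis
        proof (rule separated_matrices[where c = c and C = C and ?a1.0 = e and ?a2.0 = t and ?a3.0 = t
              and g = "\<lambda>x y z. vector [vector [0, y], vector [z, x]]"])
          show "c \<noteq> 0" by fact
          fix x y z assume sep: "absF (e * x) \<le> absF c \<Longrightarrow> x = 0" "absF (t * y) \<le> absF c \<Longrightarrow> y = 0"
            "absF (t * z) \<le> absF c \<Longrightarrow> z = 0"
            and "entries_le (absF c) (C ** vector [vector [0, y], vector [z, x]] +
              vector [vector [0, y], vector [z, x]] ** C)"
          then have h: "absF (2 * e * x + b * z + d * y) \<le> absF c" "absF (b * x + t * y) \<le> absF c"
              "absF (d * x + t * z) \<le> absF c" "absF (b * z + d * y) \<le> absF c"
            unfolding anti by simp_all
          have "e * x = (1 / 2) * ((2 * e * x + b * z + d * y) - (b * z + d * y))" by simp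
          also have "absF \<dots> \<le> absF c" by (intro absF_diff_leI absF_mult_le[OF eq_refl[OF half]] h)
          finally have x: "x = 0" by (rule sep)
          then show "x = 0 \<and> y = 0 \<and> z = 0" using h(2,3) sep(2,3) by simp
        qed (use t e in \<open>auto simp: matrix_2_eq_iff OD_def forall_2 OF_iff tr power2_eq_square\<close>)
      qed
    next
      case ae
      then have ae0: "a \<noteq> 0" "e \<noteq> 0" using M_pos by auto
      \<comment> \<open>Eliminating \<open>x\<close> and \<open>w\<close> from the upper right entry
        by means of the diagonal ones changes \<open>t * y\<close> into
        \<open>t * y * (1 - u)\<close>. Since \<open>b\<close> and \<open>d\<close> are strictly
        smaller than the norm, \<open>1 - u\<close> is a unit.\<close>
      define u where "u = b * d / (2 * a * e)"
      have "absF b * absF d < ?M * ?M" using ae M_pos by (intro mult_strict_mono) auto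
      then have "absF u < 1" using ae two M_pos by (simp add: u_def absF_divide absF_mult)
      then have u1: "absF (1 - u) = 1" using absF_add_eq[of "- u" 1] by simp
      have ba: "absF (b / (2 * a)) \<le> 1" "absF (b / (2 * e)) \<le> 1"
        using ae two M_pos by (simp_all add: absF_divide absF_mult)
      show ?thesis
      proof (rule separated_matrices[where c = c and C = C and ?a1.0 = a and ?a2.0 = e and ?a3.0 = t
            and g = "\<lambda>x w y. vector [vector [x, y], vector [0, w]]"])
        show "c \<noteq> 0" by fact
        fix x w y assume sep: "absF (a * x) \<le> absF c \<Longrightarrow> x = 0" "absF (e * w) \<le> absF c \<Longrightarrow> w = 0"
          "absF (t * y) \<le> absF c \<Longrightarrow> y = 0"
          and "entries_le (absF c) (C ** vector [vector [x, y], vector [0, w]] +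
            vector [vector [x, y], vector [0, w]] ** C)"
        then have h: "absF (2 * a * x + d * y) \<le> absF c" "absF (b * (x + w) + t * y) \<le> absF c"
            "absF (2 * e * w + d * y) \<le> absF c" unfolding anti by simp_all
        have "t * y * (1 - u) = b * (x + w) + t * y - b / (2 * a) * (2 * a * x + d * y)
            - b / (2 * e) * (2 * e * w + d * y)"
          using ae0 by (simp add: defs(5) u_def field_simps)
        also have "absF \<dots> \<le> absF c"
          by (intro absF_diff_leI absF_mult_le[OF ba(1)] absF_mult_le[OF ba(2)] h)
        finally have "absF (t * y) \<le> absF c" by (simp add: absF_mult u1)
        then have y: "y = 0" by (rule sep)
        have "absF (2 * a * x) = absF (a * x)" "absF (2 * e * w) = absF (e * w)"
          using two by (simp_all add: absF_mult)
        then show "x = 0 \<and> w = 0 \<and> y = 0" using h(1,3) sep(1,2) y by simp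
      qed (use ae in \<open>auto simp: matrix_2_eq_iff OD_def forall_2 OF_iff tr power2_eq_square\<close>)
    qed
  qed
  then show ?thesis using that by blast
qed

end

text \<open>Polarised Cayley-Hamilton: CY + YC is tr(Y) C + tr(C) Y plus a scalar, and subtracting
  the adjugate removes the scalar. The asymmetric right-hand side isolates C \<open>\<eta>\<close>,
  which for C = A \<open>adjugate \<eta>\<close> is a multiple of nrd(\<open>\<eta>\<close>), so
  only tr(C) survives modulo it.\<close>

lemma anticommutator_adjugate:
  "(C ** Y + Y ** C - adjugate (C ** Y + Y ** C)) ** \<eta> =
    (2 * trace Y) *m (C ** \<eta>) - (2 * trace C) *m (adjugate Y ** \<eta>)"
  for C Y :: "'a::comm_ring_1^2^2"
  by (simp add: matrix_2_simps trace_2 algebra_simps)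

section \<open>Cyclicity of \<open>\<eta>\<^sup>\<dagger> O\<^sub>D \<eta>\<close> modulo the determinant\<close>

text \<open>Cyclicity in terms of elements instead of cosets, with the generator existentially
  quantified: the vanishing statement names no generator, so one has to be constructed.\<close>

definition has_generator :: "'f::nonarch_local_field^2^2 \<Rightarrow> bool" where
  "has_generator \<eta> \<longleftrightarrow> (\<exists>N0\<in>OD. \<forall>A\<in>OD. \<exists>s\<in>OF. \<exists>B\<in>OD.
    adjugate \<eta> ** A ** \<eta> = s *m (adjugate \<eta> ** N0 ** \<eta>) + det \<eta> *m B)"

abbreviation swapM :: "'a::comm_ring_1^2^2" where
  "swapM \<equiv> vector [vector [0, 1], vector [1, 0]]"

text \<open>A column swap conjugates \<open>adjugate \<eta> ** A ** \<eta>\<close> by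
  \<open>swapM\<close> and reverses its sign as well as that of the determinant; the same
  \<open>N0\<close> serves and only the error term is conjugated.\<close>

lemma has_generator_swap_right:
  assumes "has_generator (\<eta> ** swapM)" shows "has_generator \<eta>"
proof -
  obtain N0 where N0: "N0 \<in> OD" and *: "\<And>A. A \<in> OD \<Longrightarrow> \<exists>s\<in>OF. \<exists>B\<in>OD.
    adjugate (\<eta> ** swapM) ** A ** (\<eta> ** swapM) =
      s *m (adjugate (\<eta> ** swapM) ** N0 ** (\<eta> ** swapM)) + det (\<eta> ** swapM) *m B"
    using assms unfolding has_generator_def by blast
  show ?thesis unfolding has_generator_def
  proof (intro bexI[OF _ N0] ballI)
    fix A :: "'a^2^2" assume "A \<in> OD"
    then obtain s B where s: "s \<in> OF" and B: "B \<in> OD" and eq: "adjugate (\<eta> ** swapM) ** A ** (\<eta> ** swapM) =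
      s *m (adjugate (\<eta> ** swapM) ** N0 ** (\<eta> ** swapM)) + det (\<eta> ** swapM) *m B"
      using * by blast
    have "adjugate \<eta> ** A ** \<eta> = s *m (adjugate \<eta> ** N0 ** \<eta>) + det \<eta> *m (swapM ** B ** swapM)"
      using eq by (simp add: matrix_2_simps algebra_simps)
    moreover have "swapM ** B ** swapM \<in> OD"
      using B by (simp add: OD_iff entries_le_2 matrix_mult_nth_2)
    ultimately show "\<exists>s\<in>OF. \<exists>B\<in>OD.
        adjugate \<eta> ** A ** \<eta> = s *m (adjugate \<eta> ** N0 ** \<eta>) + det \<eta> *m B" using s by blast
  qed
qed

text \<open>A row swap acts on the inner factor instead, so \<open>A\<close> and the generator are
  conjugated and the error term stays.\<close>

lemma has_generator_swap_left:
  assumes "has_generator (swapM ** \<eta>)" shows "has_generator \<eta>"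
proof -
  obtain N0 where N0: "N0 \<in> OD" and *: "\<And>A. A \<in> OD \<Longrightarrow> \<exists>s\<in>OF. \<exists>B\<in>OD.
    adjugate (swapM ** \<eta>) ** A ** (swapM ** \<eta>) =
      s *m (adjugate (swapM ** \<eta>) ** N0 ** (swapM ** \<eta>)) + det (swapM ** \<eta>) *m B"
    using assms unfolding has_generator_def by blast
  have OD': "swapM ** B ** swapM \<in> OD" if "B \<in> OD" for B :: "'a^2^2"
    using that by (simp add: OD_iff entries_le_2 matrix_mult_nth_2)
  show ?thesis unfolding has_generator_def
  proof (intro bexI[OF _ OD'[OF N0]] ballI)
    fix A :: "'a^2^2" assume "A \<in> OD"
    from *[OF OD'[OF this]] obtain s B where s: "s \<in> OF" and B: "B \<in> OD" and
      eq: "adjugate (swapM ** \<eta>) ** (swapM ** A ** swapM) ** (swapM ** \<eta>) =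
      s *m (adjugate (swapM ** \<eta>) ** N0 ** (swapM ** \<eta>)) + det (swapM ** \<eta>) *m B"
      by blast
    have "adjugate \<eta> ** A ** \<eta> = s *m (adjugate \<eta> ** (swapM ** N0 ** swapM) ** \<eta>) + det \<eta> *m B"
      using eq by (simp add: matrix_2_simps algebra_simps)
    then show "\<exists>s\<in>OF. \<exists>B\<in>OD.
        adjugate \<eta> ** A ** \<eta> = s *m (adjugate \<eta> ** (swapM ** N0 ** swapM) ** \<eta>) + det \<eta> *m B"
      using s B by blast
  qed
qed

text \<open>Modulo its determinant, \<open>\<eta>\<close> is the product of its first column \<open>(a, c)\<close> and a row, so
  \<open>\<eta>\<^sup>\<dagger>A\<eta>\<close> is determined by the linear form \<open>(-c, a) A (a, c)\<^sup>T\<close>, its lower left entry.\<close>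

lemma has_generator_unit_11:
  fixes \<eta> :: "'f::nonarch_local_field^2^2"
  assumes OD: "\<eta> \<in> OD" and unit: "absF (\<eta>$1$1) = 1"
  shows "has_generator \<eta>"
proof -
  define a b c e where defs: "a = \<eta>$1$1" "b = \<eta>$1$2" "c = \<eta>$2$1" "e = \<eta>$2$2"
  define u where "u = inverse a"
  have a0: "a \<noteq> 0" using unit by (auto simp: defs)
  have au: "a * u = 1" using a0 by (simp add: u_def)
  have int: "a \<in> OF" "b \<in> OF" "c \<in> OF" "e \<in> OF" using OD by (simp_all add: OD_def defs)
  have u: "u \<in> OF" using unit by (simp add: u_def defs OF_iff absF_inverse)
  \<comment> \<open>The factor \<open>u * u\<close> normalises \<open>N0\<close> so that the linear
    form takes the value \<open>a * (u * u) * a = 1\<close> on it.\<close>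
  define N0 :: "'f^2^2" where "N0 = vector [vector [0, 0], vector [u * u, 0]]"
  have N0: "N0 \<in> OD" using u by (simp add: N0_def OD_def forall_2 OF_mult OF_zero)
  show ?thesis unfolding has_generator_def
  proof (intro bexI[OF _ N0] ballI)
    fix A :: "'f^2^2" assume A: "A \<in> OD"
    define p r s w where A_defs: "p = A$1$1" "r = A$1$2" "s = A$2$1" "w = A$2$2"
    have A_int: "p \<in> OF" "r \<in> OF" "s \<in> OF" "w \<in> OF" using A by (simp_all add: OD_def A_defs)
    define l where "l = - c * (p * a + r * c) + a * (s * a + w * c)"
    \<comment> \<open>Comparing lower left entries forces the coefficient \<open>l\<close> and a
      zero in \<open>B\<close>; the remaining entries of \<open>B\<close> solve the other three
      equations, division by the determinant being possible because \<open>a\<close> is a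
      unit.\<close>
    define B22 where "B22 = u * (a * w - c * r)"
    define B :: "'f^2^2" where
      "B = vector [vector [u * (p * a + r * c), u * (p * b + r * e) - b * u * B22], vector [0, B22]]"
    have "l \<in> OF" unfolding l_def using int A_int by (intro OF_add OF_mult OF_minus)
    moreover have "B \<in> OD" using int A_int u
      by (auto simp: B_def B22_def OD_def forall_2 OF_zero intro!: OF_add OF_diff OF_mult OF_minus)
    moreover have "adjugate \<eta> ** A ** \<eta> = l *m (adjugate \<eta> ** N0 ** \<eta>) + det \<eta> *m B"
      unfolding matrix_2_eq_iff
      apply (simp add: matrix_mult_nth_2 det_2 N0_def B_def B22_def l_def defs[symmetric] A_defs[symmetric])
      using au by (intro conjI; algebra)
    ultimately show "\<exists>s\<in>OF. \<exists>B\<in>OD.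
        adjugate \<eta> ** A ** \<eta> = s *m (adjugate \<eta> ** N0 ** \<eta>) + det \<eta> *m B" by blast
  qed
qed

lemma has_generator:
  fixes \<eta> :: "'f::nonarch_local_field^2^2"
  assumes OD: "\<eta> \<in> OD" and unit: "absF (\<eta>$i$j) = 1"
  shows "has_generator \<eta>"
proof -
  have *: "swapM ** B \<in> OD" "B ** swapM \<in> OD" if "B \<in> OD" for B :: "'f^2^2"
    using that by (simp_all add: OD_iff entries_le_2 matrix_mult_nth_2)
  consider "i = 1" "j = 1" | "i = 1" "j = 2" | "i = 2" "j = 1" | "i = 2" "j = 2"
    using exhaust_2 by blast
  then show ?thesis
  proof cases
    case 1 then show ?thesis using has_generator_unit_11 OD unit by blast
  next
    case 2
    then show ?thesis using unit OD *
      by (intro has_generator_swap_right[OF has_generator_unit_11]) (simp_all add: matrix_mult_nth_2)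
  next
    case 3
    then show ?thesis using unit OD *
      by (intro has_generator_swap_left[OF has_generator_unit_11]) (simp_all add: matrix_mult_nth_2)
  next
    case 4
    then show ?thesis using unit OD *
      by (intro has_generator_swap_left[OF has_generator_swap_right[OF has_generator_unit_11]])
        (simp_all add: matrix_mult_nth_2)
  qed
qed

section \<open>Lattices in \<open>M\<^sub>2(F)\<close> and \<open>M\<^sub>2(F)\<^sup>n\<close>\<close>

lemma ODn_iff: "Y \<in> ODn \<longleftrightarrow> (\<forall>i. Y$i \<in> OD)"
  by (simp add: ODn_def)

context local_field
begin

lemma transversal_OD:
  fixes c :: 'f
  assumes "c \<noteq> 0" "absF c \<le> 1"
  obtains R :: "('f^2^2) set" where "transversal OD {A. entries_le (absF c) A} R"
proof -
  obtain R :: "'f set" where "transversal OF {x. absF x \<le> absF c} R"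
    using transversal_OF assms by blast
  from transversal_vec[OF transversal_vec[OF this, where 'n = 2], where 'n = 2] show ?thesis
    by (intro that) (simp add: OD_def entries_le_def)
qed

lemma transversal_ODn:
  fixes c :: 'f
  assumes "c \<noteq> 0" "absF c \<le> 1"
  obtains R :: "('f^2^2^'n) set" where "transversal ODn {Y. \<forall>i. entries_le (absF c) (Y$i)} R"
proof -
  obtain R :: "('f^2^2) set" where "transversal OD {A. entries_le (absF c) A} R"
    using transversal_OD assms by blast
  from transversal_vec[OF this, where 'n = 'n] show ?thesis by (intro that) (simp add: ODn_def)
qed

lemma open_entries_le:
  assumes "0 < r"
  shows "open {A :: 'f^2^2. entries_le r A}"
proof -
  have "open {x :: 'f. absF x \<le> r}" by (rule open_ball_absF[OF assms])
  then have "open {v :: 'f^2. \<forall>j. absF (v$j) \<le> r}"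
    using open_vector_box[of "\<lambda>_::2. {x::'f. absF x \<le> r}"] by simp
  then show ?thesis
    using open_vector_box[of "\<lambda>_::2. {v::'f^2. \<forall>j. absF (v$j) \<le> r}"] by (simp add: entries_le_def)
qed

lemma haar_integral_OD:
  fixes f :: "'f^2^2 \<Rightarrow> 'b::{banach, second_countable_topology}"
  assumes "transversal OD {A. entries_le (absF c) A} R" "haar_measure OD M" "c \<noteq> 0"
    "\<And>x h. x \<in> OD \<Longrightarrow> entries_le (absF c) h \<Longrightarrow> f (x + h) = f x"
  shows "(LINT x:OD|M. f x) = (\<Sum>r\<in>R. f r) /\<^sub>R card R"
  using assms(3,4)
  by (intro haar_integral_transversal[OF assms(1,2)] open_entries_le continuous_on_add_left_vec
      continuous_on_add_left_absF) auto

lemma haar_integral_ODn: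
  fixes f :: "'f^2^2^'n \<Rightarrow> 'b::{banach, second_countable_topology}"
  assumes "transversal ODn {Y. \<forall>i. entries_le (absF c) (Y$i)} R" "haar_measure ODn M" "c \<noteq> 0"
    "\<And>x h. x \<in> ODn \<Longrightarrow> (\<And>i. entries_le (absF c) (h$i)) \<Longrightarrow> f (x + h) = f x"
  shows "(LINT x:ODn|M. f x) = (\<Sum>r\<in>R. f r) /\<^sub>R card R"
proof (rule haar_integral_transversal[OF assms(1,2)])
  have "open {A :: 'f^2^2. entries_le (absF c) A}" using assms(3) by (intro open_entries_le) simp
  then show "open {Y :: 'f^2^2^'n. \<forall>i. entries_le (absF c) (Y$i)}"
    using open_vector_box[of "\<lambda>_. {A :: 'f^2^2. entries_le (absF c) A}"] by simp
qed (use assms(4) in \<open>auto intro!: continuous_on_add_left_vec continuous_on_add_left_absF\<close>)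

end

section \<open>Quadratic Gauss sums\<close>

locale unramified_character = local_field \<pi> for \<pi> :: "'f::nonarch_local_field" +
  fixes \<psi> :: "'f \<Rightarrow> complex"
  assumes char: "additive_character \<psi>" and unram: "unramified \<pi> \<psi>"
begin

lemma psi_add: "\<psi> (x + y) = \<psi> x * \<psi> y"
  using char by (simp add: additive_character_def)

lemma cmod_psi: "cmod (\<psi> x) = 1"
  using char by (simp add: additive_character_def)

lemma psi_OF: "x \<in> OF \<Longrightarrow> \<psi> x = 1"
  using unram by (simp add: unramified_def)

text \<open>If \<open>x\<close> is not integral, the ideal generated by \<open>x\<close> contains
  \<open>inverse \<pi>\<close> times \<open>OF\<close>, where an unramified character is
  nontrivial.\<close>

lemma psi_trivial_OF:
  assumes "\<And>y. y \<in> OF \<Longrightarrow> \<psi> (x * y) = 1"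
  shows "x \<in> OF"
proof (rule ccontr)
  assume "x \<notin> OF"
  then have x: "x \<noteq> 0" "absF (inverse x) < 1"
    by (auto simp: OF_iff absF_inverse inverse_less_1_iff)
  then have le: "absF (inverse x) \<le> inverse q" by (intro absF_lt_1_le)
  have "\<psi> (inverse \<pi> * y) = 1" if "y \<in> OF" for y
  proof -
    have "absF (inverse x * inverse \<pi>) \<le> 1"
      using mult_right_mono[OF le, of q] q_pos by (simp add: absF_mult absF_inverse absF_pi)
    then have "inverse x * inverse \<pi> * y \<in> OF" using that
      by (intro OF_mult[of "inverse x * inverse \<pi>" y]) (simp_all only: OF_iff)
    then show ?thesis using assms[of "inverse x * inverse \<pi> * y"] x by (simp add: mult.assoc[symmetric])
  qed
  then show False using unram by (simp add: unramified_def)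
qed

text \<open>Self-duality of \<open>OD\<close> under the trace pairing, tested on matrix units; the
  pairing transposes positions, so the entry (1,2) is detected by the unit at (2,1).\<close>

lemma psi_trace_trivial_OD:
  assumes "\<And>A. A \<in> OD \<Longrightarrow> \<psi> (trace (G ** A)) = 1"
  shows "G \<in> OD"
proof -
  have OD': "vector [vector [x, y], vector [z, w]] \<in> OD"
    if "x \<in> OF" "y \<in> OF" "z \<in> OF" "w \<in> OF" for x y z w :: 'f
    using that by (simp add: OD_def forall_2)
  have "G$1$1 \<in> OF"
  proof (rule psi_trivial_OF)
    fix y :: 'f assume "y \<in> OF"
    then show "\<psi> (G$1$1 * y) = 1"
      using assms[OF OD'[of y 0 0 0]] by (simp add: trace_2 matrix_mult_nth_2 OF_zero)
  qed
  moreover have "G$1$2 \<in> OF"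
  proof (rule psi_trivial_OF)
    fix y :: 'f assume "y \<in> OF"
    then show "\<psi> (G$1$2 * y) = 1"
      using assms[OF OD'[of 0 0 y 0]] by (simp add: trace_2 matrix_mult_nth_2 OF_zero)
  qed
  moreover have "G$2$1 \<in> OF"
  proof (rule psi_trivial_OF)
    fix y :: 'f assume "y \<in> OF"
    then show "\<psi> (G$2$1 * y) = 1"
      using assms[OF OD'[of 0 y 0 0]] by (simp add: trace_2 matrix_mult_nth_2 OF_zero)
  qed
  moreover have "G$2$2 \<in> OF"
  proof (rule psi_trivial_OF)
    fix y :: 'f assume "y \<in> OF"
    then show "\<psi> (G$2$2 * y) = 1"
      using assms[OF OD'[of 0 0 0 y]] by (simp add: trace_2 matrix_mult_nth_2 OF_zero)
  qed
  ultimately show ?thesis by (simp add: OD_def forall_2)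
qed

lemma psi_trace_OD_iff: "(\<forall>A\<in>OD. \<psi> (trace (A ** G)) = 1) \<longleftrightarrow> G \<in> OD"
proof -
  have comm: "trace (A ** G) = trace (G ** A)" for A
    by (simp add: trace_2 matrix_mult_nth_2 algebra_simps)
  show ?thesis
    unfolding comm using psi_trace_trivial_OD psi_OF trace_OD OD_mult by metis
qed

lemma psi_sum_trace_trivial_ODn:
  fixes G :: "'f^2^2^'n"
  assumes "\<And>Y. Y \<in> ODn \<Longrightarrow> \<psi> (\<Sum>i\<in>UNIV. trace (G$i ** Y$i)) = 1"
  shows "G \<in> ODn"
  unfolding ODn_iff
proof (intro allI psi_trace_trivial_OD)
  fix i and A :: "'f^2^2" assume A: "A \<in> OD"
  let ?Y = "(\<chi> j. if j = i then A else 0) :: 'f^2^2^'n"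
  have "?Y \<in> ODn" using A by (simp add: ODn_iff OD_zero)
  from assms[OF this] have "\<psi> (\<Sum>j\<in>UNIV. trace (G$j ** ?Y$j)) = 1" .
  also have "(\<Sum>j\<in>UNIV. trace (G$j ** ?Y$j)) = (\<Sum>j\<in>UNIV. if j = i then trace (G$i ** A) else 0)"
    by (intro sum.cong) (auto simp: trace_2 matrix_mult_nth_2)
  finally show "\<psi> (trace (G$i ** A)) = 1" by simp
qed

end

text \<open>\<open>C / c\<close> is the matrix of the quadratic form and \<open>G / c\<close> that of the linear form; \<open>N\<close> is a
  common period of all functions involved.\<close>

locale gauss_sum = unramified_character \<pi> \<psi> for \<pi> :: "'f::nonarch_local_field" and \<psi> +
  fixes \<upsilon> :: "'f^'n" and c N :: 'f and C :: "'f^2^2" and G :: "'f^2^2^'n" and R :: "('f^2^2^'n) set"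
  assumes two: "absF (2::'f) = 1" and \<upsilon>: "\<And>i. absF (\<upsilon>$i) = 1"
    and c: "c \<noteq> 0" and N: "N \<noteq> 0" "absF N \<le> 1" "absF N \<le> absF c"
    and C: "C \<in> OD" and G: "\<And>i. entries_le (absF c / absF N) (G$i)"
    and trans: "transversal ODn {Y. \<forall>i. entries_le (absF N) (Y$i)} R"
begin

sublocale transversal ODn "{Y. \<forall>i. entries_le (absF N) (Y$i)}" R
  by (rule trans)

definition phase :: "'f^2^2^'n \<Rightarrow> 'f" where
  "phase Y = (\<Sum>i\<in>UNIV. \<upsilon>$i * trace (C ** (Y$i ** Y$i)) + trace (G$i ** Y$i)) / c"

text \<open>Cyclicity of the trace turns tr(C(XY + YX)) into tr((CX + XC)Y), which is how the
  anticommutator arises.\<close>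

definition polar :: "'f^2^2^'n \<Rightarrow> 'f^2^2^'n \<Rightarrow> 'f" where
  "polar X Y = (\<Sum>i\<in>UNIV. \<upsilon>$i * trace ((C ** X$i + X$i ** C) ** Y$i)) / c"

lemma phase_add: "phase (X + Y) = phase X + phase Y + polar X Y"
  unfolding phase_def polar_def add_divide_distrib[symmetric] sum.distrib[symmetric]
  by (intro arg_cong2[where f = divide] sum.cong refl)
    (simp add: trace_2 matrix_mult_nth_2 algebra_simps)

lemma polar_add_right: "polar X (Y + Z) = polar X Y + polar X Z"
  unfolding polar_def add_divide_distrib[symmetric] sum.distrib[symmetric]
  by (intro arg_cong2[where f = divide] sum.cong refl)
    (simp add: trace_2 matrix_mult_nth_2 algebra_simps)

lemma polar_commute: "polar X Y = polar Y X"
  unfolding polar_def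
  by (intro arg_cong2[where f = divide] sum.cong refl)
    (simp add: trace_2 matrix_mult_nth_2 algebra_simps)

lemma polar_self: "polar X X = 2 * (\<Sum>i\<in>UNIV. \<upsilon>$i * trace (C ** (X$i ** X$i))) / c"
  unfolding polar_def sum_distrib_left
  by (intro arg_cong2[where f = divide] sum.cong refl)
    (simp add: trace_2 matrix_mult_nth_2 algebra_simps)

lemma trace_small: "entries_le d A \<Longrightarrow> absF (trace A) \<le> d"
  by (simp add: trace_2 entries_le_2 absF_add_leI)

lemma divide_c_OF: "absF x \<le> absF c \<Longrightarrow> x / c \<in> OF"
  using c by (simp add: OF_iff absF_divide)

lemma upsilon_mult: "absF (\<upsilon>$i * x) = absF x"
  by (simp add: absF_mult \<upsilon>)

lemma polar_OF:
  assumes "\<And>i. entries_le (absF c) (C ** X$i + X$i ** C)" "Y \<in> ODn"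
  shows "polar X Y \<in> OF"
  unfolding polar_def
proof (intro divide_c_OF absF_sum_le)
  fix i
  have "entries_le (absF c * 1) ((C ** X$i + X$i ** C) ** Y$i)"
    using assms by (intro entries_le_mult) (auto simp: ODn_iff OD_iff)
  then show "absF (\<upsilon>$i * trace ((C ** X$i + X$i ** C) ** Y$i)) \<le> absF c"
    unfolding upsilon_mult by (intro trace_small) simp
qed simp

lemma polar_small:
  assumes "\<And>i. entries_le (absF N) (h$i)" "Y \<in> ODn"
  shows "polar h Y \<in> OF"
proof (rule polar_OF[OF _ assms(2)])
  fix i
  have "entries_le (absF N) (C ** h$i + h$i ** C)"
    using entries_le_mult[of 1 C "absF N" "h$i"] entries_le_mult[of "absF N" "h$i" 1 C] assms(1) C
    by (auto simp: OD_iff intro!: entries_le_add)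
  then show "entries_le (absF c) (C ** h$i + h$i ** C)" using N(3) entries_le_mono by blast
qed

lemma psi_polar_small:
  assumes "X \<in> ODn" "\<And>i. entries_le (absF N) (h$i)"
  shows "\<psi> (polar h X) = 1" "\<psi> (polar X h) = 1"
  using psi_OF[OF polar_small[OF assms(2,1)]] by (simp_all add: polar_commute[of X h])

lemma phase_small:
  assumes "\<And>i. entries_le (absF N) (h$i)"
  shows "phase h \<in> OF"
  unfolding phase_def
proof (intro divide_c_OF absF_sum_le absF_add_leI)
  fix i
  have "entries_le (1 * (absF N * absF N)) (C ** (h$i ** h$i))"
    using C assms by (intro entries_le_mult) (auto simp: OD_iff)
  moreover have "1 * (absF N * absF N) \<le> absF c"
    using N mult_mono[of "absF N" 1 "absF N" "absF c"] by simp
  ultimately show "absF (\<upsilon>$i * trace (C ** (h$i ** h$i))) \<le> absF c"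
    unfolding upsilon_mult using trace_small entries_le_mono by blast
  \<comment> \<open>The bound on \<open>G\<close> in the locale is chosen so that the linear part is
    integral on the period lattice.\<close>
  have "entries_le (absF c / absF N * absF N) (G$i ** h$i)"
    by (intro entries_le_mult G assms)
  then show "absF (trace (G$i ** h$i)) \<le> absF c" using N(1) by (intro trace_small) simp
qed simp

lemma psi_phase_add: "\<psi> (phase (X + Y)) = \<psi> (phase X) * \<psi> (phase Y) * \<psi> (polar X Y)"
  by (simp add: phase_add psi_add)

lemma psi_phase_periodic:
  assumes "Y \<in> ODn" "\<And>i. entries_le (absF N) (h$i)"
  shows "\<psi> (phase (Y + h)) = \<psi> (phase Y)"
  using psi_OF[OF phase_small[OF assms(2)]] psi_OF[OF polar_small[OF assms(2,1)]]
  by (simp add: psi_phase_add polar_commute[of Y h])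

text \<open>The radical is the kernel of the anticommutator modulo \<open>c\<close>, by self-duality
  applied to its multiples by \<open>\<upsilon>$i / c\<close>.\<close>

lemma polar_trivial_iff:
  assumes "X \<in> ODn"
  shows "(\<forall>Y\<in>ODn. \<psi> (polar X Y) = 1) \<longleftrightarrow> (\<forall>i. entries_le (absF c) (C ** X$i + X$i ** C))"
proof
  assume *: "\<forall>Y\<in>ODn. \<psi> (polar X Y) = 1"
  let ?G = "(\<chi> i. (\<upsilon>$i / c) *m (C ** X$i + X$i ** C)) :: 'f^2^2^'n"
  have "polar X Y = (\<Sum>i\<in>UNIV. trace (?G$i ** Y$i))" for Y
    unfolding polar_def sum_divide_distrib
    by (intro sum.cong refl) (simp add: scaleM_mult_left trace_scaleM)
  then have "?G \<in> ODn" using * by (intro psi_sum_trace_trivial_ODn) simp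
  then have "entries_le 1 ((\<upsilon>$i / c) *m (C ** X$i + X$i ** C))" for i
    by (simp add: ODn_iff OD_iff)
  then show "\<forall>i. entries_le (absF c) (C ** X$i + X$i ** C)"
    using c by (simp add: entries_le_2 absF_mult absF_divide \<upsilon>)
next
  assume "\<forall>i. entries_le (absF c) (C ** X$i + X$i ** C)"
  then show "\<forall>Y\<in>ODn. \<psi> (polar X Y) = 1" using polar_OF psi_OF by blast
qed

text \<open>Nonvanishing makes the full phase trivial on the radical. Its quadratic part is integral
  there, so the linear character \<open>ch\<close> is trivial on the radical too and is therefore of
  the form \<open>polar _ Y\<close>.\<close>

lemma gauss_sum_nonzero:
  assumes nz: "(\<Sum>Y\<in>R. \<psi> (phase Y)) \<noteq> 0"
  obtains Y where "Y \<in> ODn" "\<And>i. entries_le (absF c) (G$i - \<upsilon>$i *m (C ** Y$i + Y$i ** C))"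
proof -
  define ch where "ch Y = \<psi> ((\<Sum>i\<in>UNIV. trace (G$i ** Y$i)) / c)" for Y :: "'f^2^2^'n"
  have lin: "(\<Sum>i\<in>UNIV. trace (G$i ** (X + Y)$i)) / c =
      (\<Sum>i\<in>UNIV. trace (G$i ** X$i)) / c + (\<Sum>i\<in>UNIV. trace (G$i ** Y$i)) / c" for X Y :: "'f^2^2^'n"
    unfolding add_divide_distrib[symmetric] sum.distrib[symmetric]
    by (intro arg_cong2[where f = divide] sum.cong refl)
      (simp add: trace_2 matrix_mult_nth_2 algebra_simps)
  have rad: "ch X = 1" if X: "X \<in> ODn" and triv: "\<And>Y. Y \<in> ODn \<Longrightarrow> \<psi> (polar X Y) = 1" for X
  proof -
    have "\<psi> (phase X) = 1"
    proof (rule quadratic_sum_nonzero[where f = "\<lambda>Y. \<psi> (phase Y)" and \<beta> = "\<lambda>X Y. \<psi> (polar X Y)"])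
      show "\<psi> (phase (Y + h)) = \<psi> (phase Y)"
        if "Y \<in> ODn" "h \<in> {Y. \<forall>i. entries_le (absF N) (Y$i)}" for Y h
        using that by (intro psi_phase_periodic) simp_all
      show "\<psi> (polar Y X) = 1" if "Y \<in> ODn" for Y
        using triv[OF that] by (simp add: polar_commute)
    qed (use nz X in \<open>simp_all add: psi_phase_add\<close>)
    have int: "polar X X \<in> OF" using X triv polar_trivial_iff polar_OF by blast
    \<comment> \<open>The quadratic part is half of \<open>polar X X\<close>; halving preserves
      integrality because 2 is a unit.\<close>
    have "(1 / 2 :: 'f) \<in> OF" using two by (simp add: OF_iff absF_divide)
    from OF_mult[OF this int]
    have "(\<Sum>i\<in>UNIV. \<upsilon>$i * trace (C ** (X$i ** X$i))) / c \<in> OF"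
      unfolding polar_self by simp
    moreover have "phase X = (\<Sum>i\<in>UNIV. \<upsilon>$i * trace (C ** (X$i ** X$i))) / c
        + (\<Sum>i\<in>UNIV. trace (G$i ** X$i)) / c"
      by (simp add: phase_def sum.distrib add_divide_distrib)
    ultimately show ?thesis using \<open>\<psi> (phase X) = 1\<close> psi_OF by (simp add: psi_add ch_def)
  qed
  obtain Y where Y: "Y \<in> ODn" "\<And>X. X \<in> ODn \<Longrightarrow> ch X = \<psi> (polar X Y)"
  proof (rule character_trivial_on_radical[where \<xi> = ch and \<beta> = "\<lambda>X Y. \<psi> (polar X Y)"])
    fix X Y :: "'f^2^2^'n"
    show "ch (X + Y) = ch X * ch Y" unfolding ch_def lin by (rule psi_add)
  next
    fix X Y Z :: "'f^2^2^'n"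
    show "\<psi> (polar X (Y + Z)) = \<psi> (polar X Y) * \<psi> (polar X Z)"
      by (simp add: polar_add_right psi_add)
    show "\<psi> (polar (X + Y) Z) = \<psi> (polar X Z) * \<psi> (polar Y Z)"
      by (simp add: polar_commute[of _ Z] polar_add_right psi_add)
  next
    fix X h :: "'f^2^2^'n" assume "X \<in> ODn" "h \<in> {Y. \<forall>i. entries_le (absF N) (Y$i)}"
    then show "\<psi> (polar X h) = 1" "\<psi> (polar h X) = 1" by (simp_all add: psi_polar_small)
  next
    fix X :: "'f^2^2^'n" assume "X \<in> ODn" "\<And>Y. Y \<in> ODn \<Longrightarrow> \<psi> (polar X Y) = 1"
    then show "ch X = 1" by (rule rad)
  qed (simp_all add: cmod_psi)
  \<comment> \<open>The discrepancy between the linear form and the polar form, scaled so that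
    integrality of \<open>?E\<close> is the desired congruence modulo \<open>c\<close>.\<close>
  let ?E = "\<chi> i. inverse c *m (G$i - \<upsilon>$i *m (C ** Y$i + Y$i ** C))"
  have "\<psi> (\<Sum>i\<in>UNIV. trace (?E$i ** X$i)) = 1" if X: "X \<in> ODn" for X
  proof -
    have "(\<Sum>i\<in>UNIV. trace (G$i ** X$i)) / c = (\<Sum>i\<in>UNIV. trace (?E$i ** X$i)) + polar Y X"
      unfolding polar_def sum_divide_distrib sum.distrib[symmetric]
      using c by (intro sum.cong refl) (simp add: trace_2 matrix_mult_nth_2 field_simps)
    then have "\<psi> (\<Sum>i\<in>UNIV. trace (?E$i ** X$i)) * \<psi> (polar X Y) = \<psi> (polar X Y)"
      using Y(2)[OF X] by (simp add: ch_def psi_add polar_commute[of Y X])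
    moreover have "\<psi> (polar X Y) \<noteq> 0" using cmod_psi[of "polar X Y"] by auto
    ultimately show ?thesis by simp
  qed
  then have "?E \<in> ODn" by (rule psi_sum_trace_trivial_ODn)
  then have "entries_le (absF c) (G$i - \<upsilon>$i *m (C ** Y$i + Y$i ** C))" for i
    using c entries_le_scaleM_iff[of "inverse c" "absF c" "G$i - \<upsilon>$i *m (C ** Y$i + Y$i ** C)"]
    by (simp add: ODn_iff OD_iff absF_inverse)
  then show ?thesis using that Y(1) by blast
qed

text \<open>Tuples from a separated set \<open>T\<close> of matrices are separated modulo the
  radical in all n coordinates, so the radical has index at least the n-th power of the bound for
  \<open>T\<close>. The squared, multiplied-out form postpones roots to
  \<open>bound_arith\<close>.\<close>

lemma gauss_sum_bound:
  "(cmod (\<Sum>Y\<in>R. \<psi> (phase Y)) / card R)\<^sup>2 *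
    ((max (normD \<pi> C) (absF c) / absF c)\<^sup>2 * (max (absF (trace C)) (absF c) / absF c)) ^ CARD('n) \<le> 1"
proof -
  define K where "K = (max (normD \<pi> C) (absF c) / absF c)\<^sup>2 * (max (absF (trace C)) (absF c) / absF c)"
  let ?S = "{X::'f^2^2^'n. \<forall>i. entries_le (absF c) (C ** X$i + X$i ** C)}"
  obtain T where T: "finite T" "T \<subseteq> OD" "K \<le> card T"
    "\<And>X Y. X \<in> T \<Longrightarrow> Y \<in> T \<Longrightarrow> entries_le (absF c) (C ** (X - Y) + (X - Y) ** C) \<Longrightarrow> X = Y"
    using anticommutator_separated[OF two c] unfolding K_def by blast
  let ?T = "{X::'f^2^2^'n. \<forall>i. X$i \<in> T}"
  have K0: "0 \<le> K" by (simp add: K_def le_max_iff_disj)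
  have "card ?T * card (R \<inter> ?S) \<le> card R"
  proof (rule card_subgroup_le)
    fix X Y assume XY: "X \<in> ?S" "Y \<in> ?S"
    have "C ** (X - Y)$i + (X - Y)$i ** C = (C ** X$i + X$i ** C) - (C ** Y$i + Y$i ** C)" for i
      by (simp add: matrix_mult_diff_left matrix_mult_diff_right)
    then show "X - Y \<in> ?S" using XY by (simp add: entries_le_diff)
  next
    show "{Y. \<forall>i. entries_le (absF N) (Y$i)} \<subseteq> ?S"
    proof clarify
      fix Y :: "'f^2^2^'n" and i assume *: "\<forall>i. entries_le (absF N) (Y$i)"
      then have "Y \<in> ODn" using entries_le_mono N(2) by (auto simp: ODn_iff OD_iff)
      then show "entries_le (absF c) (C ** Y$i + Y$i ** C)"
        using polar_trivial_iff polar_small psi_OF * by blast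
    qed
    show "finite ?T" using T(1) by (rule finite_card_vec)
    show "?T \<subseteq> ODn" using T(2) by (auto simp: ODn_iff subset_iff)
    fix X Y assume "X \<in> ?T" "Y \<in> ?T" "X - Y \<in> ?S"
    then show "X = Y" using T(4) by (simp add: vec_eq_iff)
  qed
  then have card: "K ^ CARD('n) * card (R \<inter> ?S) \<le> card R"
  proof -
    have "K ^ CARD('n) \<le> real (card T) ^ CARD('n)" using T(3) K0 by (rule power_mono)
    also have "\<dots> = card ?T" using finite_card_vec(2)[OF T(1), where 'n = 'n] by simp
    finally have "K ^ CARD('n) * card (R \<inter> ?S) \<le> real (card ?T) * card (R \<inter> ?S)"
      by (intro mult_right_mono) auto
    also have "\<dots> \<le> card R"
      using \<open>card ?T * card (R \<inter> ?S) \<le> card R\<close> by (simp flip: of_nat_mult)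
    finally show ?thesis .
  qed
  have "{X \<in> R. \<forall>Y\<in>ODn. \<psi> (polar X Y) = 1} = R \<inter> ?S"
    using polar_trivial_iff R_subset by blast
  moreover have "(cmod (\<Sum>Y\<in>R. \<psi> (phase Y)))\<^sup>2 \<le>
      card R * card {X \<in> R. \<forall>Y\<in>ODn. \<psi> (polar X Y) = 1}"
  proof (rule quadratic_sum_norm[where f = "\<lambda>Y. \<psi> (phase Y)" and \<beta> = "\<lambda>X Y. \<psi> (polar X Y)"])
    fix X h :: "'f^2^2^'n" assume *: "X \<in> ODn" "h \<in> {Y. \<forall>i. entries_le (absF N) (Y$i)}"
    show "\<psi> (phase (X + h)) = \<psi> (phase X)" using * by (intro psi_phase_periodic) simp_all
    show "\<psi> (polar X h) = 1"
      using * by (intro psi_polar_small) simp_all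
  qed (simp_all add: psi_phase_add cmod_psi polar_add_right psi_add)
  ultimately have "(cmod (\<Sum>Y\<in>R. \<psi> (phase Y)))\<^sup>2 \<le> real (card R) * card (R \<inter> ?S)" by simp
  then have "(cmod (\<Sum>Y\<in>R. \<psi> (phase Y)))\<^sup>2 * K ^ CARD('n) \<le>
      real (card R) * card (R \<inter> ?S) * K ^ CARD('n)"
    using K0 by (intro mult_right_mono) auto
  also have "\<dots> \<le> (real (card R))\<^sup>2"
    using mult_left_mono[OF card, of "card R"] by (simp add: power2_eq_square mult_ac)
  finally show ?thesis
    unfolding K_def[symmetric] using card_R_pos by (simp add: power_divide divide_le_eq_1)
qed

end

section \<open>The integral \<open>I\<^sub>0\<close>\<close>

lemma class_nrdD:
  assumes "class_nrd \<eta> X = class_nrd \<eta> Y"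
  obtains B where "B \<in> OD" "X = Y + det \<eta> *m B"
proof -
  have "X = X + det \<eta> *m 0" by (simp add: scaleM_zero)
  then have "X \<in> class_nrd \<eta> X" unfolding class_nrd_def using OD_zero by blast
  then have "X \<in> class_nrd \<eta> Y" unfolding assms .
  then show ?thesis using that by (auto simp: class_nrd_def)
qed

lemma class_adj_eq_iff: "class_adj \<eta> X = class_adj \<eta> Y \<longleftrightarrow> (\<exists>B\<in>OD. X - Y = B ** adjugate \<eta>)"
proof
  assume eq: "class_adj \<eta> X = class_adj \<eta> Y"
  have "X = X + 0 ** adjugate \<eta>" by (simp add: matrix_2_simps)
  then have "X \<in> class_adj \<eta> X" unfolding class_adj_def using OD_zero by blast
  then have "X \<in> class_adj \<eta> Y" unfolding eq .
  then obtain B where "B \<in> OD" "X = Y + B ** adjugate \<eta>" by (auto simp: class_adj_def)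
  then show "\<exists>B\<in>OD. X - Y = B ** adjugate \<eta>" by auto
next
  assume "\<exists>B\<in>OD. X - Y = B ** adjugate \<eta>"
  then obtain B where B: "B \<in> OD" "X - Y = B ** adjugate \<eta>" by blast
  have XY: "X + E ** adjugate \<eta> = Y + (E + B) ** adjugate \<eta>"
    and YX: "Y + E ** adjugate \<eta> = X + (E - B) ** adjugate \<eta>" for E
    using B(2) by (simp_all add: matrix_mult_add_left matrix_mult_diff_left algebra_simps)
  show "class_adj \<eta> X = class_adj \<eta> Y"
  proof (intro equalityI subsetI)
    fix M assume "M \<in> class_adj \<eta> X"
    then obtain E where "E \<in> OD" "M = X + E ** adjugate \<eta>" by (auto simp: class_adj_def)
    then show "M \<in> class_adj \<eta> Y" using XY OD_add[OF _ B(1)] unfolding class_adj_def by blast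
  next
    fix M assume "M \<in> class_adj \<eta> Y"
    then obtain E where "E \<in> OD" "M = Y + E ** adjugate \<eta>" by (auto simp: class_adj_def)
    then show "M \<in> class_adj \<eta> X" using YX OD_diff[OF _ B(1)] unfolding class_adj_def by blast
  qed
qed

lemma trace_quadP: "trace (M ** quadP \<upsilon> Y) = (\<Sum>i\<in>UNIV. \<upsilon>$i * trace (M ** (Y$i ** Y$i)))"
  by (simp add: quadP_def trace_2 matrix_mult_nth_2[of M] sum_distrib_left sum.distrib[symmetric]
      algebra_simps)

lemma trace_dotD: "trace (dotD \<gamma> Y) = (\<Sum>i\<in>UNIV. trace (\<gamma>$i ** Y$i))"
  by (simp add: dotD_def trace_2 sum.distrib)

lemma quadP_OD:
  assumes "\<And>i. \<upsilon>$i \<in> OF" "Y \<in> ODn"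
  shows "quadP \<upsilon> Y \<in> OD"
proof -
  have "(\<upsilon>$i *m (Y$i ** Y$i))$j$k \<in> OF" for i j k
    using OD_scaleM[OF assms(1)[of i] OD_mult[of "Y$i" "Y$i"]] assms(2) by (simp add: ODn_iff OD_def)
  then show ?thesis by (simp add: quadP_def OD_def sum_component OF_sum)
qed

text \<open>\<open>D\<close>, \<open>dn\<close>, \<open>r\<close>, \<open>M\<close>,
  \<open>t\<close>, \<open>J\<close> stand for |nrd(\<open>\<eta>\<close>)|, the norm of
  \<open>\<delta>\<close>, |c|, the norm of C, |tr C| and the normalised Gauss sum. Squaring clears
  the half-integral exponents and reduces the claim to the n-th power of
  \<open>1 \<le> K * (D * r\<^sup>2 / (m1 * m2\<^sup>2))\<close>.\<close>

lemma bound_arith: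
  fixes D r m1 m2 M t J dn :: real
  assumes pos: "0 < D" "0 < dn" and r: "r = dn * D" "r \<le> D" and J: "0 \<le> J"
    and m1: "D \<le> m1" "m1 \<le> max t D" and m2: "r \<le> m2" "m2 \<le> max M r"
    and bound: "J\<^sup>2 * ((max M r / r)\<^sup>2 * (max t r / r)) ^ n \<le> 1"
  shows "J \<le> D powr (3 * real n / 2) * dn ^ n / (m1 powr (real n / 2) * m2 ^ n)"
proof -
  have rpos: "0 < r" using pos r by simp
  have m1pos: "0 < m1" and m2pos: "0 < m2" using m1(1) m2(1) pos(1) rpos by linarith+
  define b where "b = D powr (3 * real n / 2) * dn ^ n / (m1 powr (real n / 2) * m2 ^ n)"
  have b0: "0 \<le> b" using pos m2pos by (simp add: b_def)
  have sq: "(x powr (y / 2))\<^sup>2 = x powr y" if "0 < x" for x y :: real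
    using that by (simp add: power2_eq_square flip: powr_add)
  have square_power: "(x ^ n)\<^sup>2 = (x\<^sup>2) ^ n" for x :: real
    by (simp only: power_mult[symmetric] mult.commute)
  have "b\<^sup>2 = D ^ (3 * n) * (dn ^ n)\<^sup>2 / (m1 ^ n * (m2 ^ n)\<^sup>2)"
    using sq[OF pos(1), of "3 * real n"] sq[OF m1pos, of "real n"] powr_realpow[OF pos(1), of "3 * n"]
      powr_realpow[OF m1pos, of n]
    by (simp add: b_def power_divide power_mult_distrib)
  also have "\<dots> = (D ^ 3 * dn\<^sup>2 / (m1 * m2\<^sup>2)) ^ n"
    by (simp only: square_power power_mult power_divide power_mult_distrib)
  also have "D ^ 3 * dn\<^sup>2 = D * r\<^sup>2"
    by (simp add: r(1) power2_eq_square power3_eq_cube)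
  finally have b2: "b\<^sup>2 = (D * r\<^sup>2 / (m1 * m2\<^sup>2)) ^ n" .
  define K where "K = (max M r / r)\<^sup>2 * (max t r / r)"
  have K: "0 < K" using rpos by (simp add: K_def less_max_iff_disj)
  have "1 \<le> K * (D * r\<^sup>2 / (m1 * m2\<^sup>2))"
  proof -
    \<comment> \<open>\<open>m1\<close> is controlled relative to \<open>D\<close>, whereas the
      volume involves \<open>t\<close> relative to \<open>r\<close>; the passage uses
      \<open>r \<le> D\<close>.\<close>
    have "m1 / D \<le> max t r / r"
    proof (cases "t \<le> D")
      case True
      then have "m1 / D \<le> 1" using m1(2) pos(1) by (simp add: max_def)
      also have "1 \<le> max t r / r" using rpos by simp
      finally show ?thesis .
    next
      case False
      then have "m1 \<le> t" using m1(2) by simp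
      then have "m1 / D \<le> t / r" using r(2) rpos m1pos by (intro frac_le) auto
      also have "\<dots> \<le> max t r / r" using rpos by (intro divide_right_mono) auto
      finally show ?thesis .
    qed
    moreover have "m2\<^sup>2 / r\<^sup>2 \<le> (max M r / r)\<^sup>2"
      unfolding power_divide using m2(2) m2pos by (intro divide_right_mono power_mono) auto
    ultimately have "m2\<^sup>2 / r\<^sup>2 * (m1 / D) \<le> K"
      unfolding K_def using m1pos pos(1) by (intro mult_mono) auto
    then show ?thesis using rpos m1pos m2pos pos(1) by (simp add: field_simps)
  qed
  then have "1 \<le> K ^ n * b\<^sup>2"
    unfolding b2 power_mult_distrib[symmetric] by (rule one_le_power)
  moreover have "J\<^sup>2 * K ^ n \<le> 1" using bound by (simp add: K_def)
  ultimately have "K ^ n * J\<^sup>2 \<le> K ^ n * b\<^sup>2" by (simp add: mult.commute)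
  then have "J\<^sup>2 \<le> b\<^sup>2" using K by simp
  then show ?thesis using b0 unfolding b_def by (rule power2_le_imp_le)
qed

locale quadratic_integral = unramified_character \<pi> \<psi>
  for \<pi> :: "'f::nonarch_local_field" and \<psi> +
  fixes \<upsilon> :: "'f^'n" and dY :: "('f^2^2^'n) measure" and dZ :: "('f^2^2) measure"
    and \<delta> \<eta> :: "'f^2^2" and \<gamma> :: "'f^2^2^'n"
  assumes two: "absF (2::'f) = 1" and \<upsilon>: "\<And>i. absF (\<upsilon>$i) = 1"
    and dY: "haar_measure ODn dY" and dZ: "haar_measure OD dZ"
    and \<delta>: "\<delta> \<in> OD" "invertible \<delta>" and \<eta>: "\<delta> = \<pi> powi (valD \<pi> \<delta>) *m \<eta>"
begin

definition p where "p = \<pi> powi (valD \<pi> \<delta>)"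
text \<open>One modulus serves both forms: the inverse of \<open>\<delta>\<close> is
  \<open>inverse c *m adjugate \<eta>\<close>, and \<open>\<gamma>\<close> over the determinant of
  \<open>\<delta>\<close> is \<open>\<gamma>'\<close> over \<open>c\<close>.\<close>

definition c where "c = p * det \<eta>"
definition \<gamma>' where "\<gamma>' = \<pi> powi (- valD \<pi> \<delta>) *mn \<gamma>"

lemma p_nz: "p \<noteq> 0"
  using pi_nz by (simp add: p_def)

lemma delta_eq: "\<delta> = p *m \<eta>"
  using \<eta> by (simp add: p_def)

lemma det_delta: "det \<delta> = p * c"
  by (subst delta_eq) (simp add: det_2 c_def algebra_simps)

lemma c_nz: "c \<noteq> 0" and det_eta_nz: "det \<eta> \<noteq> 0"
  using \<delta>(2) invertible_det_nz[of \<delta>] by (auto simp: det_delta c_def)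

lemma normD_delta: "normD \<pi> \<delta> = absF p"
proof -
  have "det \<delta> \<noteq> 0" using det_delta p_nz c_nz by simp
  moreover have "det (0 :: 'f^2^2) = 0" by (simp add: det_2)
  ultimately have "\<delta> \<noteq> 0" by metis
  then show ?thesis unfolding p_def by (rule normD_eq_absF_powi)
qed

lemma absF_p_le: "absF p \<le> 1"
  using \<delta>(1) by (simp add: normD_delta[symmetric] normD_le_iff OD_iff)

lemma normD_eta: "normD \<pi> \<eta> = 1"
  using normD_delta normD_scaleM[of p \<eta>, folded delta_eq] p_nz by simp

lemma eta_OD: "\<eta> \<in> OD"
  using normD_le_iff[of \<eta> 1] by (simp add: OD_iff normD_eta)

lemma det_eta_le: "absF (det \<eta>) \<le> 1"
  using det_OD[OF eta_OD] by (simp add: OF_iff)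

lemma absF_c_eq: "absF c = normD \<pi> \<delta> * absF (det \<eta>)"
  by (simp add: c_def absF_mult normD_delta)

lemma absF_c_le: "absF c \<le> absF (det \<eta>)"
  using absF_p_le by (simp add: c_def absF_mult mult_left_le_one_le)

lemma has_generator_eta: "has_generator \<eta>"
proof -
  have "\<exists>i j. absF (\<eta>$i$j) = 1"
    using normD_eta by (simp add: normD_eq max_def split: if_splits) blast+
  then show ?thesis using has_generator eta_OD by blast
qed

lemma gamma_nth: "\<gamma>$i = p *m (\<gamma>'$i)"
  using pi_nz by (simp add: \<gamma>'_def scaleMn_def p_def scaleM_assoc power_int_minus scaleM_one)

lemma gamma_in_iff: "\<gamma> \<in> (*mn) p ` ODn \<longleftrightarrow> \<gamma>' \<in> ODn"
proof
  assume "\<gamma> \<in> (*mn) p ` ODn"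
  then obtain Y where Y: "Y \<in> ODn" "\<gamma> = p *mn Y" by blast
  have "p *m (\<gamma>'$i) = p *m (Y$i)" for i
    using arg_cong[OF Y(2), of "\<lambda>Y. Y$i"] unfolding gamma_nth by (simp add: scaleMn_def)
  then have "\<gamma>' = Y"
    using p_nz by (simp add: vec_eq_iff[of _ Y] matrix_2_eq_iff)
  then show "\<gamma>' \<in> ODn" using Y(1) by simp
next
  assume *: "\<gamma>' \<in> ODn"
  have "\<gamma> = p *mn \<gamma>'" by (simp add: vec_eq_iff[of \<gamma>] scaleMn_def gamma_nth)
  then show "\<gamma> \<in> (*mn) p ` ODn" using * by blast
qed

definition summand :: "'f^2^2 \<Rightarrow> 'f^2^2^'n \<Rightarrow> complex" where
  "summand A Y = \<psi> ((\<Sum>i\<in>UNIV. \<upsilon>$i * trace (A ** adjugate \<eta> ** (Y$i ** Y$i)) + trace (\<gamma>'$i ** Y$i)) / c)"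

text \<open>The matrix \<open>?Q\<close> becomes integral after multiplication by \<open>c\<close>,
  so \<open>A \<mapsto> \<psi> (trace (A ** ?Q))\<close> is trivial on the period lattice; by
  self-duality its average is the indicator of integrality of \<open>?Q\<close>.\<close>

lemma integrand_eq:
  assumes R: "transversal OD {A. entries_le (absF N) A} R" and N: "absF N \<le> absF c"
    and Y: "Y \<in> ODn"
  shows "indicator OD (matrix_inv \<delta> ** quadP \<upsilon> Y) * \<psi> (trace (dotD \<gamma> Y) / det \<delta>) =
    (\<Sum>A\<in>R. summand A Y) / card R"
proof -
  interpret transversal OD "{A. entries_le (absF N) A}" R by (rule R)
  let ?Q = "matrix_inv \<delta> ** quadP \<upsilon> Y"
  let ?l = "trace (dotD \<gamma> Y) / det \<delta>"
  have Q: "?Q = inverse c *m (adjugate \<eta> ** quadP \<upsilon> Y)"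
  proof -
    have "adjugate \<delta> = p *m adjugate \<eta>" by (subst delta_eq) (simp add: matrix_2_eq_iff)
    moreover have "inverse (p * c) * p = inverse c" using p_nz by simp
    ultimately have "matrix_inv \<delta> = inverse c *m adjugate \<eta>"
      by (simp only: matrix_inv_2[OF \<delta>(2)] det_delta scaleM_assoc)
    then show ?thesis by (simp add: scaleM_mult_left)
  qed
  have P: "adjugate \<eta> ** quadP \<upsilon> Y \<in> OD"
    using \<upsilon> Y eta_OD by (intro OD_mult quadP_OD) (simp_all add: OD_adjugate OF_iff)
  have "(\<Sum>A\<in>R. \<psi> (trace (A ** ?Q))) = (if \<forall>A\<in>OD. \<psi> (trace (A ** ?Q)) = 1 then of_nat (card R) else 0)"
  proof (rule sum_character)
    fix A B :: "'f^2^2"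
    show "\<psi> (trace ((A + B) ** ?Q)) = \<psi> (trace (A ** ?Q)) * \<psi> (trace (B ** ?Q))"
      by (simp add: psi_add[symmetric] trace_2 matrix_mult_nth_2[of _ ?Q] algebra_simps)
  next
    fix h :: "'f^2^2" assume "h \<in> {A. entries_le (absF N) A}"
    then have "entries_le (absF N * 1) (h ** (adjugate \<eta> ** quadP \<upsilon> Y))"
      using P by (intro entries_le_mult) (simp_all add: OD_iff)
    then have "absF (trace (h ** (adjugate \<eta> ** quadP \<upsilon> Y))) \<le> absF c"
      using N by (auto simp: trace_2 entries_le_2 intro!: absF_add_leI)
    then show "\<psi> (trace (h ** ?Q)) = 1"
      unfolding Q scaleM_mult_right trace_scaleM using c_nz
      by (intro psi_OF) (simp add: OF_iff absF_divide divide_le_eq_1 flip: divide_inverse_commute)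
  qed
  then have ind: "indicator OD ?Q = (\<Sum>A\<in>R. \<psi> (trace (A ** ?Q))) / card R"
    using card_R_pos by (simp add: psi_trace_OD_iff indicator_def)
  have l: "?l = (\<Sum>i\<in>UNIV. trace (\<gamma>'$i ** Y$i)) / c"
    using p_nz by (simp add: trace_dotD gamma_nth scaleM_mult_left trace_scaleM det_delta
        sum_distrib_left[symmetric])
  have "\<psi> (trace (A ** ?Q)) * \<psi> ?l = summand A Y" for A
    unfolding psi_add[symmetric] l Q summand_def scaleM_mult_right trace_scaleM matrix_mul_assoc trace_quadP
      sum.distrib add_divide_distrib by (simp add: divide_inverse mult.commute)
  then show ?thesis unfolding ind by (simp add: sum_distrib_right)
qed

text \<open>Integrality of \<open>\<gamma>'\<close> is a conclusion and cannot be presupposed, so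
  \<open>N\<close> has to absorb the size of \<open>\<gamma>'\<close> as well.\<close>

definition period :: "'f \<Rightarrow> bool" where
  "period N \<longleftrightarrow> N \<noteq> 0 \<and> absF N \<le> 1 \<and> absF N \<le> absF c \<and> (\<forall>i. entries_le (absF c / absF N) (\<gamma>'$i))"

lemma ex_period: obtains N where "period N"
proof -
  define m where "m = 1 + normDn \<pi> \<gamma>'"
  have le: "entries_le (normDn \<pi> \<gamma>') (\<gamma>'$i)" for i using normDn_le_iff by blast
  have m: "1 \<le> m"
    using order_trans[OF absF_nonneg, of "\<gamma>'$undefined$1$1" "normDn \<pi> \<gamma>'"] le
    by (simp add: m_def entries_le_def)
  obtain N :: 'f where N: "N \<noteq> 0" "absF N < min 1 (absF c) / m"
    using ex_small[of "min 1 (absF c) / m"] c_nz m by auto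
  then have *: "absF N * m < min 1 (absF c)" using m by (simp add: pos_less_divide_eq)
  moreover have "absF N * 1 \<le> absF N * m" using m by (intro mult_left_mono) auto
  ultimately have "absF N \<le> 1" "absF N \<le> absF c" by simp_all
  moreover have "normDn \<pi> \<gamma>' \<le> absF c / absF N"
    using * N(1) by (simp add: m_def pos_le_divide_eq algebra_simps) (smt (verit) absF_nonneg)
  ultimately have "period N" using N(1) le entries_le_mono by (auto simp: period_def)
  then show ?thesis by (rule that)
qed

lemma gauss_sum_summand:
  assumes "period N" "transversal ODn {Y. \<forall>i. entries_le (absF N) (Y$i)} R" "A \<in> OD"
  shows "gauss_sum \<pi> \<psi> \<upsilon> c N (A ** adjugate \<eta>) \<gamma>' R"
    "summand A = (\<lambda>Y. \<psi> (gauss_sum.phase \<upsilon> c (A ** adjugate \<eta>) \<gamma>' Y))"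
proof -
  show "gauss_sum \<pi> \<psi> \<upsilon> c N (A ** adjugate \<eta>) \<gamma>' R"
    using assms two \<upsilon> c_nz OD_mult[OF assms(3), of "adjugate \<eta>"] eta_OD
    by (intro gauss_sum.intro gauss_sum_axioms.intro unramified_character_axioms)
      (simp_all add: period_def OD_adjugate)
  from gauss_sum.phase_def[OF this]
  show "summand A = (\<lambda>Y. \<psi> (gauss_sum.phase \<upsilon> c (A ** adjugate \<eta>) \<gamma>' Y))"
    by (simp add: summand_def fun_eq_iff)
qed

lemma I0_eq:
  assumes N: "period N" and R1: "transversal OD {A. entries_le (absF N) A} R1"
    and R2: "transversal ODn {Y. \<forall>i. entries_le (absF N) (Y$i)} R2"
  shows "I0 dY \<psi> \<upsilon> \<delta> \<gamma> = (\<Sum>A\<in>R1. (\<Sum>Y\<in>R2. summand A Y) / card R2) / card R1"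
proof -
  interpret R1: transversal OD "{A. entries_le (absF N) A}" R1 by (rule R1)
  interpret R2: transversal ODn "{Y. \<forall>i. entries_le (absF N) (Y$i)}" R2 by (rule R2)
  let ?f = "\<lambda>Y. indicator OD (matrix_inv \<delta> ** quadP \<upsilon> Y) * \<psi> (trace (dotD \<gamma> Y) / det \<delta>)"
  have N': "N \<noteq> 0" "absF N \<le> absF c" using N by (auto simp: period_def)
  have f: "?f Y = (\<Sum>A\<in>R1. summand A Y) / card R1" if "Y \<in> ODn" for Y
    by (rule integrand_eq[OF R1 N'(2) that])
  have per: "summand A (Y + h) = summand A Y"
    if "A \<in> OD" "Y \<in> ODn" "\<And>i. entries_le (absF N) (h$i)" for A Y h
    unfolding gauss_sum_summand(2)[OF N R2 that(1)]
    by (rule gauss_sum.psi_phase_periodic[OF gauss_sum_summand(1)[OF N R2 that(1)] that(2,3)])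
  have "I0 dY \<psi> \<upsilon> \<delta> \<gamma> = (\<Sum>Y\<in>R2. ?f Y) /\<^sub>R card R2"
    unfolding I0_def
  proof (rule haar_integral_ODn[OF R2 dY N'(1)])
    fix Y h :: "'f^2^2^'n" assume Y: "Y \<in> ODn" and h: "\<And>i. entries_le (absF N) (h$i)"
    then have "Y + h \<in> ODn" using R2.K_add R2.H_subset by blast
    \<comment> \<open>Periodicity of the integrand, indicator included, is inherited from the
      summands of its expansion.\<close>
    moreover have "(\<Sum>A\<in>R1. summand A (Y + h)) = (\<Sum>A\<in>R1. summand A Y)"
      using R1.R_subset per Y h by (intro sum.cong) auto
    ultimately show "?f (Y + h) = ?f Y" using Y f by simp
  qed
  also have "\<dots> = (\<Sum>Y\<in>R2. (\<Sum>A\<in>R1. summand A Y) / card R1) / card R2"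
  proof -
    have "(\<Sum>Y\<in>R2. ?f Y) = (\<Sum>Y\<in>R2. (\<Sum>A\<in>R1. summand A Y) / card R1)"
      using R2.R_subset by (intro sum.cong refl f) auto
    then show ?thesis by (simp add: scaleR_conv_of_real divide_inverse mult.commute)
  qed
  also have "\<dots> = (\<Sum>A\<in>R1. (\<Sum>Y\<in>R2. summand A Y) / card R2) / card R1"
    unfolding sum_divide_distrib by (subst sum.swap) (simp add: mult.commute)
  finally show ?thesis .
qed

text \<open>The bridge between \<open>star_condition\<close>, a congruence modulo
  nrd(\<open>\<eta>\<close>) after multiplication by \<open>\<eta>\<close>, and
  \<open>Theta\<close>, which lives modulo left multiples of \<open>adjugate \<eta>\<close>.\<close>

lemma eta_cancel:
  assumes "X ** \<eta> = det \<eta> *m E" shows "X = E ** adjugate \<eta>"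
proof -
  have "det \<eta> *m X = det \<eta> *m (E ** adjugate \<eta>)"
    using arg_cong[OF assms, of "\<lambda>M. M ** adjugate \<eta>"]
    by (simp only: matrix_mul_assoc[symmetric] adjugate_mult mat_scaleM scaleM_mult_left)
  then show ?thesis using det_eta_nz by (simp add: matrix_2_eq_iff)
qed

lemma gamma_eta_eq:
  assumes gen: "\<And>A. A \<in> OD \<Longrightarrow> \<exists>s\<in>OF. \<exists>B\<in>OD.
      adjugate \<eta> ** A ** \<eta> = s *m (adjugate \<eta> ** N0 ** \<eta>) + det \<eta> *m B"
    and A: "A \<in> OD" and Y: "Y \<in> ODn"
    and le: "\<And>i. entries_le (absF c) (\<gamma>'$i - \<upsilon>$i *m (A ** adjugate \<eta> ** Y$i + Y$i ** (A ** adjugate \<eta>)))"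
  shows "\<exists>s\<in>OF. \<exists>B\<in>OD. \<gamma>'$i ** \<eta> = s *m (A ** adjugate \<eta> ** N0 ** \<eta>) + det \<eta> *m B"
proof -
  let ?d = "det \<eta>"
  obtain s B where s: "s \<in> OF" and B: "B \<in> OD" and
    eq: "adjugate \<eta> ** Y$i ** \<eta> = s *m (adjugate \<eta> ** N0 ** \<eta>) + ?d *m B"
    using gen[of "Y$i"] Y by (auto simp: ODn_iff)
  obtain E where E: "E \<in> OD" and
    eqE: "\<gamma>'$i - \<upsilon>$i *m (A ** adjugate \<eta> ** Y$i + Y$i ** (A ** adjugate \<eta>)) = c *m E"
    using le[of i] scaleM_OD_iff[OF c_nz] by blast
  have "\<gamma>'$i = \<upsilon>$i *m (A ** adjugate \<eta> ** Y$i + Y$i ** (A ** adjugate \<eta>)) + c *m E"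
    using eqE by (simp add: algebra_simps)
  \<comment> \<open>Regrouped to exhibit \<open>adjugate \<eta> ** Y$i ** \<eta>\<close>, to which
    the generator applies, and \<open>adjugate \<eta> ** \<eta>\<close>, which is the scalar
    \<open>det \<eta>\<close>.\<close>
  then have "\<gamma>'$i ** \<eta> = \<upsilon>$i *m (A ** (adjugate \<eta> ** Y$i ** \<eta>) + Y$i ** A ** (adjugate \<eta> ** \<eta>))
      + c *m (E ** \<eta>)"
    by (simp only: matrix_mult_add_left scaleM_mult_left matrix_mul_assoc)
  also have "\<dots> = (\<upsilon>$i * s) *m (A ** adjugate \<eta> ** N0 ** \<eta>)
      + ?d *m (\<upsilon>$i *m (A ** B + Y$i ** A) + p *m (E ** \<eta>))"
  proof -
    have "A ** (s *m (adjugate \<eta> ** N0 ** \<eta>) + ?d *m B) = s *m (A ** adjugate \<eta> ** N0 ** \<eta>) + ?d *m (A ** B)"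
      by (simp only: matrix_mult_add_right scaleM_mult_right matrix_mul_assoc)
    then show ?thesis unfolding eq adjugate_mult mat_scaleM
      by (simp add: scaleM_add scaleM_assoc c_def mult_ac add_ac)
  qed
  finally have "\<gamma>'$i ** \<eta> = (\<upsilon>$i * s) *m (A ** adjugate \<eta> ** N0 ** \<eta>)
      + ?d *m (\<upsilon>$i *m (A ** B + Y$i ** A) + p *m (E ** \<eta>))" .
  moreover have "\<upsilon>$i * s \<in> OF" using \<upsilon> s by (intro OF_mult) (simp_all add: OF_iff)
  moreover have "\<upsilon>$i *m (A ** B + Y$i ** A) + p *m (E ** \<eta>) \<in> OD"
    using \<upsilon> A B E Y eta_OD absF_p_le
    by (intro OD_add OD_scaleM OD_mult) (simp_all add: OF_iff ODn_iff)
  ultimately show ?thesis by blast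
qed

text \<open>Division by an entry of largest absolute value produces an entry 1. The factor
  \<open>e\<close> split off here is later absorbed into \<open>M0\<close>.\<close>

lemma primitive_decomposition:
  fixes l :: "'f^'n"
  assumes l: "l \<in> OFn"
  obtains e \<mu> where "e \<in> OF" "\<mu> \<in> primitive \<pi>" "\<And>i. l$i = e * \<mu>$i"
proof -
  have prim: "\<mu> \<in> primitive \<pi>" if "\<mu> \<in> OFn" "absF (\<mu>$i) = 1" for \<mu> :: "'f^'n" and i
  proof -
    have "\<mu> \<notin> (*s) \<pi> ` OFn"
    proof
      assume "\<mu> \<in> (*s) \<pi> ` OFn"
      then obtain v where "v \<in> OFn" "\<mu> = \<pi> *s v" by blast
      then have "absF (\<mu>$i) \<le> inverse q"
        using q_pos by (simp add: OFn_def OF_iff absF_mult absF_pi)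
      then show False using that(2) q_gt_1 inverse_less_1_iff[of q] by linarith
    qed
    then show ?thesis using that(1) by (simp add: primitive_def)
  qed
  let ?S = "range (\<lambda>i. absF (l$i))"
  have "Max ?S \<in> ?S" by (rule Max_in) auto
  then obtain i0 where "Max ?S = absF (l$i0)" by blast
  then have i0: "absF (l$i) \<le> absF (l$i0)" for i
    using Max_ge[of ?S "absF (l$i)"] by simp
  show ?thesis
  proof (cases "l$i0 = 0")
    case True
    \<comment> \<open>The zero vector has no canonical direction; any primitive vector does, with
      \<open>e = 0\<close>.\<close>
    then have "l$i = 0 * (vec 1 :: 'f^'n)$i" for i using i0[of i] by simp
    moreover have "(vec 1 :: 'f^'n) \<in> primitive \<pi>" by (rule prim[where i = i0]) (simp_all add: OFn_def OF_one)
    ultimately show ?thesis using that OF_zero by blast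
  next
    case False
    let ?\<mu> = "\<chi> i. l$i / l$i0"
    have "?\<mu> \<in> primitive \<pi>"
      using i0 False by (intro prim[where i = i0]) (simp_all add: OFn_def OF_iff absF_divide divide_le_eq_1)
    moreover have "l$i = l$i0 * ?\<mu>$i" for i using False by simp
    moreover have "l$i0 \<in> OF" using l by (simp add: OFn_def)
    ultimately show ?thesis using that by blast
  qed
qed

lemma summand_nonzero:
  assumes "period N" "transversal ODn {Y. \<forall>i. entries_le (absF N) (Y$i)} R" "A \<in> OD"
    "(\<Sum>Y\<in>R. summand A Y) \<noteq> 0"
  obtains Y where "Y \<in> ODn" "\<And>i. entries_le (absF c)
    (\<gamma>'$i - \<upsilon>$i *m (A ** adjugate \<eta> ** Y$i + Y$i ** (A ** adjugate \<eta>)))"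
  using gauss_sum.gauss_sum_nonzero[OF gauss_sum_summand(1)[OF assms(1-3)]] assms(4)
  unfolding gauss_sum_summand(2)[OF assms(1-3)] by blast

theorem I0_nonzero:
  assumes "I0 dY \<psi> \<upsilon> \<delta> \<gamma> \<noteq> 0"
  shows "\<gamma>' \<in> ODn" "\<exists>M0\<in>OD. \<exists>\<mu>\<in>primitive \<pi>. star_condition \<pi> \<delta> \<eta> \<gamma> M0 \<mu>"
proof -
  obtain N where N: "period N" by (rule ex_period)
  then have N': "N \<noteq> 0" "absF N \<le> 1" by (auto simp: period_def)
  obtain R1 :: "('f^2^2) set" where R1: "transversal OD {A. entries_le (absF N) A} R1"
    using transversal_OD N' by blast
  obtain R2 :: "('f^2^2^'n) set" where R2: "transversal ODn {Y. \<forall>i. entries_le (absF N) (Y$i)} R2"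
    using transversal_ODn N' by blast
  have "\<exists>A\<in>R1. (\<Sum>Y\<in>R2. summand A Y) \<noteq> 0"
    using assms unfolding I0_eq[OF N R1 R2] by (auto intro: ccontr)
  then obtain A where A: "A \<in> OD" "(\<Sum>Y\<in>R2. summand A Y) \<noteq> 0"
    using transversal.R_subset[OF R1] by blast
  obtain Y where Y: "Y \<in> ODn" "\<And>i. entries_le (absF c)
      (\<gamma>'$i - \<upsilon>$i *m (A ** adjugate \<eta> ** Y$i + Y$i ** (A ** adjugate \<eta>)))"
    using summand_nonzero[OF N R2 A] by blast
  have "absF c \<le> 1" using absF_c_le det_eta_le by linarith
  show "\<gamma>' \<in> ODn"
    unfolding ODn_iff
  proof
    fix i
    let ?X = "\<upsilon>$i *m (A ** adjugate \<eta> ** Y$i + Y$i ** (A ** adjugate \<eta>))"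
    have "\<gamma>'$i - ?X \<in> OD" using entries_le_mono[OF Y(2) \<open>absF c \<le> 1\<close>] unfolding OD_iff .
    moreover have "?X \<in> OD"
      using \<upsilon> A(1) Y(1) eta_OD by (intro OD_add OD_scaleM OD_mult) (simp_all add: OF_iff ODn_iff OD_adjugate)
    ultimately show "\<gamma>'$i \<in> OD" using OD_add by fastforce
  qed
  obtain N0 where N0: "N0 \<in> OD" and gen: "\<And>A. A \<in> OD \<Longrightarrow> \<exists>s\<in>OF. \<exists>B\<in>OD.
      adjugate \<eta> ** A ** \<eta> = s *m (adjugate \<eta> ** N0 ** \<eta>) + det \<eta> *m B"
    using has_generator_eta unfolding has_generator_def by blast
  have "\<forall>i. \<exists>s B. s \<in> OF \<and> B \<in> OD \<and> \<gamma>'$i ** \<eta> = s *m (A ** adjugate \<eta> ** N0 ** \<eta>) + det \<eta> *m B"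
    using gamma_eta_eq[OF gen A(1) Y] by blast
  then obtain s B where sB: "\<And>i. s i \<in> OF" "\<And>i. B i \<in> OD"
      "\<And>i. \<gamma>'$i ** \<eta> = s i *m (A ** adjugate \<eta> ** N0 ** \<eta>) + det \<eta> *m B i"
    by metis
  have "(\<chi> i. s i) \<in> OFn" using sB(1) by (simp add: OFn_def)
  then obtain e \<mu> where e: "e \<in> OF" and \<mu>: "\<mu> \<in> primitive \<pi>" and l: "\<And>i. s i = e * \<mu>$i"
    by (rule primitive_decomposition) simp
  let ?M0 = "e *m (A ** adjugate \<eta> ** N0)"
  have "?M0 \<in> OD" using e A(1) N0 eta_OD by (intro OD_scaleM OD_mult) (simp_all add: OD_adjugate)
  moreover have "star_condition \<pi> \<delta> \<eta> \<gamma> ?M0 \<mu>"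
    unfolding star_condition_def \<gamma>'_def[symmetric]
  proof (rule bexI)
    show "(\<chi> i. B i) \<in> ODn" using sB(2) by (simp add: ODn_iff)
    show "\<gamma>' **n \<eta> = tupleM \<mu> ?M0 **n \<eta> + det \<eta> *mn (\<chi> i. B i)"
      unfolding vec_eq_iff[of "\<gamma>' **n \<eta>"]
      by (simp add: rmultMn_def tupleM_def scaleMn_def sB(3) l scaleM_mult_left scaleM_assoc mult.commute)
  qed
  ultimately show "\<exists>M0\<in>OD. \<exists>\<mu>\<in>primitive \<pi>. star_condition \<pi> \<delta> \<eta> \<gamma> M0 \<mu>" using \<mu> by blast
qed

section \<open>The condition measured by \<open>W\<close>, and the final bound\<close>

abbreviation in_Theta :: "'f^2^2 \<Rightarrow> 'f^2^2 \<Rightarrow> 'f^'n \<Rightarrow> 'f^2^2 \<Rightarrow> bool" where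
  "in_Theta N0 M0 \<mu> Z \<equiv> reduce_adj \<eta> (tupleM \<mu> M0) \<in> (\<lambda>l. Theta \<eta> N0 l Z) ` OFn"

lemma in_Theta_iff: "in_Theta N0 M0 \<mu> Z \<longleftrightarrow>
  (\<exists>l\<in>OFn. \<forall>i. \<exists>B\<in>OD. \<mu>$i *m M0 - l$i *m (Z ** adjugate \<eta> ** N0) = B ** adjugate \<eta>)"
proof -
  have "in_Theta N0 M0 \<mu> Z \<longleftrightarrow> (\<exists>l\<in>OFn. reduce_adj \<eta> (tupleM \<mu> M0) = Theta \<eta> N0 l Z)" by blast
  then show ?thesis
    unfolding Theta_def reduce_adj_def tupleM_def by (simp add: vec_eq_iff[where 'b = 'n] class_adj_eq_iff)
qed

text \<open>A change of \<open>Z\<close> by \<open>h\<close> divisible by nrd(\<open>\<eta>\<close>)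
  changes \<open>Z ** adjugate \<eta> ** N0\<close> by a left multiple of
  \<open>adjugate \<eta>\<close>, as one sees after multiplying by \<open>\<eta>\<close> and
  cancelling.\<close>

lemma in_Theta_periodic:
  assumes N: "absF N \<le> absF c" and N0: "N0 \<in> OD" and h: "entries_le (absF N) h"
  shows "in_Theta N0 M0 \<mu> (Z + h) \<longleftrightarrow> in_Theta N0 M0 \<mu> Z"
proof -
  have imp: "in_Theta N0 M0 \<mu> (Z + h)" if "in_Theta N0 M0 \<mu> Z" and h: "entries_le (absF N) h" for Z h
  proof -
    from that(1) obtain l where l: "l \<in> OFn"
      "\<And>i. \<exists>B\<in>OD. \<mu>$i *m M0 - l$i *m (Z ** adjugate \<eta> ** N0) = B ** adjugate \<eta>"
      unfolding in_Theta_iff by blast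
    have "adjugate \<eta> ** N0 ** \<eta> \<in> OD"
      using N0 eta_OD by (intro OD_mult) (simp_all add: OD_adjugate)
    then have "entries_le (absF N * 1) (h ** (adjugate \<eta> ** N0 ** \<eta>))"
      unfolding OD_iff by (rule entries_le_mult[OF h])
    moreover have "absF N * 1 \<le> absF (det \<eta>)" using N absF_c_le by simp
    ultimately have "entries_le (absF (det \<eta>)) (h ** (adjugate \<eta> ** N0 ** \<eta>))"
      by (rule entries_le_mono)
    then obtain E where E: "E \<in> OD" "h ** (adjugate \<eta> ** N0 ** \<eta>) = det \<eta> *m E"
      using scaleM_OD_iff[OF det_eta_nz] by blast
    then have h_eq: "h ** adjugate \<eta> ** N0 = E ** adjugate \<eta>"
      by (intro eta_cancel) (simp only: matrix_mul_assoc)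
    have "\<exists>B\<in>OD. \<mu>$i *m M0 - l$i *m ((Z + h) ** adjugate \<eta> ** N0) = B ** adjugate \<eta>" for i
    proof -
      obtain B where B: "B \<in> OD" "\<mu>$i *m M0 - l$i *m (Z ** adjugate \<eta> ** N0) = B ** adjugate \<eta>"
        using l(2) by blast
      have "\<mu>$i *m M0 - l$i *m ((Z + h) ** adjugate \<eta> ** N0) =
          B ** adjugate \<eta> - l$i *m (E ** adjugate \<eta>)"
        unfolding B(2)[symmetric] h_eq[symmetric] by (simp add: matrix_mult_add_left scaleM_add)
      also have "\<dots> = (B - l$i *m E) ** adjugate \<eta>"
        by (simp add: matrix_mult_diff_left scaleM_mult_left)
      finally have "\<mu>$i *m M0 - l$i *m ((Z + h) ** adjugate \<eta> ** N0) = (B - l$i *m E) ** adjugate \<eta>" .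
      moreover have "B - l$i *m E \<in> OD"
        using B(1) E(1) l(1) by (intro OD_diff OD_scaleM) (simp_all add: OFn_def)
      ultimately show ?thesis by blast
    qed
    then show ?thesis unfolding in_Theta_iff using l(1) by blast
  qed
  have "entries_le (absF N) (- h)" using h by (simp add: entries_le_minus)
  from imp[OF _ this, of "Z + h"] imp[OF _ h, of Z] show ?thesis by auto
qed

text \<open>A real supremum dominates its members only if they are bounded; as averages of truth
  values the integrals are at most 1.\<close>

lemma W_ge:
  assumes "N \<noteq> 0" "absF N \<le> absF c" and N0: "N0 \<in> OD" and \<mu>: "\<mu> \<in> primitive \<pi>"
    and R: "transversal OD {A. entries_le (absF N) A} R"
  shows "(\<Sum>A\<in>R. of_bool (in_Theta N0 M0 \<mu> A)) / card R \<le> W TYPE('n) dZ \<pi> N0 M0 \<eta>"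
proof -
  have int: "(LINT Z:OD|dZ. of_bool (in_Theta N0 M0 \<mu> Z)) =
      (\<Sum>A\<in>R. of_bool (in_Theta N0 M0 \<mu> A) :: real) /\<^sub>R card R" for \<mu>
    by (rule haar_integral_OD[OF R dZ assms(1)]) (simp add: in_Theta_periodic[OF assms(2) N0])
  have le: "(LINT Z:OD|dZ. of_bool (in_Theta N0 M0 \<mu> Z) :: real) \<le> 1" for \<mu>
  proof -
    have "(\<Sum>A\<in>R. of_bool (in_Theta N0 M0 \<mu> A) :: real) \<le> (\<Sum>A\<in>R. 1)" by (intro sum_mono) simp
    then show ?thesis
      unfolding int using transversal.card_R_pos[OF R] by (simp add: inverse_eq_divide divide_le_eq_1)
  qed
  have "(LINT Z:OD|dZ. of_bool (in_Theta N0 M0 \<mu> Z)) \<le> W TYPE('n) dZ \<pi> N0 M0 \<eta>"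
    unfolding W_def using le by (intro cSUP_upper \<mu> bdd_aboveI2)
  then show ?thesis unfolding int by (simp add: inverse_eq_divide)
qed

text \<open>There are two expressions for \<open>\<gamma>'$i ** \<eta>\<close> modulo
  nrd(\<open>\<eta>\<close>), one from \<open>star_condition\<close> and one from
  \<open>gamma_eta_eq\<close>; their difference, with \<open>\<eta>\<close> cancelled, is the
  membership.\<close>

lemma in_Theta_if_nonzero:
  assumes gen: "cyclic_generator \<eta> N0" and star: "star_condition \<pi> \<delta> \<eta> \<gamma> M0 \<mu>"
    and A: "A \<in> OD" and Y: "Y \<in> ODn" "\<And>i. entries_le (absF c)
      (\<gamma>'$i - \<upsilon>$i *m (A ** adjugate \<eta> ** Y$i + Y$i ** (A ** adjugate \<eta>)))"
  shows "in_Theta N0 M0 \<mu> A"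
proof -
  have gen': "\<exists>s\<in>OF. \<exists>B\<in>OD. adjugate \<eta> ** A ** \<eta> = s *m (adjugate \<eta> ** N0 ** \<eta>) + det \<eta> *m B"
    if "A \<in> OD" for A
  proof -
    have "class_nrd \<eta> (adjugate \<eta> ** A ** \<eta>) \<in> (\<lambda>s. class_nrd \<eta> (s *m (adjugate \<eta> ** N0 ** \<eta>))) ` OF"
      using gen that unfolding cyclic_generator_def by blast
    then obtain s where "s \<in> OF"
      "class_nrd \<eta> (adjugate \<eta> ** A ** \<eta>) = class_nrd \<eta> (s *m (adjugate \<eta> ** N0 ** \<eta>))" by blast
    then show ?thesis using class_nrdD by metis
  qed
  obtain B where B: "B \<in> ODn" "\<gamma>' **n \<eta> = tupleM \<mu> M0 **n \<eta> + det \<eta> *mn B"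
    using star unfolding star_condition_def \<gamma>'_def by blast
  have "\<forall>i. \<exists>s E. s \<in> OF \<and> E \<in> OD \<and> \<gamma>'$i ** \<eta> = s *m (A ** adjugate \<eta> ** N0 ** \<eta>) + det \<eta> *m E"
    using gamma_eta_eq[OF gen' A Y] by blast
  then obtain s E where sE: "\<And>i. s i \<in> OF" "\<And>i. E i \<in> OD"
      "\<And>i. \<gamma>'$i ** \<eta> = s i *m (A ** adjugate \<eta> ** N0 ** \<eta>) + det \<eta> *m E i"
    by metis
  show ?thesis
    unfolding in_Theta_iff
  proof (rule bexI[where x = "\<chi> i. s i"], intro allI bexI)
    show "(\<chi> i. s i) \<in> OFn" using sE(1) by (simp add: OFn_def)
    fix i
    show "E i - B$i \<in> OD" using sE(2) B(1) by (simp add: ODn_iff OD_diff)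
    have "\<gamma>'$i ** \<eta> = \<mu>$i *m M0 ** \<eta> + det \<eta> *m B$i"
      using arg_cong[OF B(2), of "\<lambda>Y. Y$i"] by (simp add: rmultMn_def tupleM_def scaleMn_def)
    then have "\<mu>$i *m M0 ** \<eta> - s i *m (A ** adjugate \<eta> ** N0 ** \<eta>) = det \<eta> *m (E i - B$i)"
      unfolding sE(3) by (simp add: scaleM_diff algebra_simps)
    then show "\<mu>$i *m M0 - (\<chi> i. s i)$i *m (A ** adjugate \<eta> ** N0) = (E i - B$i) ** adjugate \<eta>"
      by (intro eta_cancel) (simp add: matrix_mult_diff_left scaleM_mult_left)
  qed
qed

text \<open>Data of \<open>\<gamma>'\<close> are bounded by data of C, the direction needed because
  a large C makes the Gauss sum small.\<close>

lemma gamma_bounds: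
  assumes A: "A \<in> OD" and Y: "Y \<in> ODn" "\<And>i. entries_le (absF c)
      (\<gamma>'$i - \<upsilon>$i *m (A ** adjugate \<eta> ** Y$i + Y$i ** (A ** adjugate \<eta>)))"
  shows "normDn \<pi> \<gamma>' \<le> max (normD \<pi> (A ** adjugate \<eta>)) (absF c)" (is ?th1)
    and "normDn \<pi> ((\<gamma>' - (\<chi> i. adjugate (\<gamma>'$i))) **n \<eta>) \<le>
      max (absF (trace (A ** adjugate \<eta>))) (absF (det \<eta>))" (is ?th2)
proof -
  let ?C = "A ** adjugate \<eta>"
  define X where "X i = ?C ** Y$i + Y$i ** ?C" for i
  have Yi: "entries_le 1 (Y$i)" for i using Y(1) by (simp add: ODn_iff OD_iff)
  have int: "absF (\<upsilon>$i) \<le> 1" for i by (simp add: \<upsilon>)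
  have "\<forall>i. \<exists>E\<in>OD. \<gamma>'$i - \<upsilon>$i *m X i = c *m E"
    using Y(2) scaleM_OD_iff[OF c_nz] unfolding X_def by blast
  then obtain E where E: "\<And>i. E i \<in> OD" "\<And>i. \<gamma>'$i - \<upsilon>$i *m X i = c *m E i" by metis
  have \<gamma>': "\<gamma>'$i = \<upsilon>$i *m X i + c *m E i" for i
    unfolding E(2)[symmetric] by simp
  show ?th1
    unfolding normDn_le_iff
  proof
    fix i
    have C: "entries_le (normD \<pi> ?C) ?C" by (rule entries_le_normD)
    have "entries_le (normD \<pi> ?C) (X i)"
      using entries_le_mult[OF C Yi] entries_le_mult[OF Yi C] by (simp add: X_def entries_le_add)
    then have "entries_le (normD \<pi> ?C) (\<upsilon>$i *m X i)"
      using entries_le_scaleM[of _ "X i" "\<upsilon>$i"] by (simp add: \<upsilon>)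
    moreover have "entries_le (absF c) (c *m E i)"
      using entries_le_scaleM[of 1 "E i" c] E(1) by (simp add: OD_iff)
    ultimately show "entries_le (max (normD \<pi> ?C) (absF c)) (\<gamma>'$i)"
      unfolding \<gamma>' by (intro entries_le_add) (auto elim: entries_le_mono)
  qed
  show ?th2
    unfolding normDn_le_iff
  proof
    fix i
    let ?t = "trace ?C" and ?d = "det \<eta>"
    have lin: "(\<gamma>'$i - adjugate (\<gamma>'$i)) ** \<eta> =
        \<upsilon>$i *m ((X i - adjugate (X i)) ** \<eta>) + ?d *m (p *m ((E i - adjugate (E i)) ** \<eta>))"
      unfolding \<gamma>' c_def by (simp add: matrix_2_eq_iff matrix_mult_nth_2 algebra_simps)
    have "?C ** \<eta> = ?d *m A"
      by (simp only: matrix_mul_assoc[symmetric] adjugate_mult mat_scaleM)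
    \<comment> \<open>The factor \<open>det \<eta>\<close> in the first term comes from C
      \<open>\<eta>\<close>; the other term carries tr(C).\<close>
    then have X: "(X i - adjugate (X i)) ** \<eta> = ?d *m ((2 * trace (Y$i)) *m A) - ?t *m (2 *m (adjugate (Y$i) ** \<eta>))"
      unfolding X_def anticommutator_adjugate by (simp add: scaleM_assoc mult.commute)
    have small: "entries_le (absF x) (x *m M)" if "M \<in> OD" for x :: 'f and M
      using entries_le_scaleM[of 1 M x] that by (simp add: OD_iff)
    have two': "(2::'f) \<in> OF" by (simp add: OF_iff two)
    have Yi': "Y$i \<in> OD" using Y(1) by (simp add: ODn_iff)
    let ?m = "max (absF ?t) (absF ?d)"
    have "entries_le ?m (?d *m ((2 * trace (Y$i)) *m A))"
      by (rule entries_le_mono[OF small]) (use two' Yi' A trace_OD in \<open>auto intro!: OD_scaleM OF_mult\<close>)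
    moreover have "entries_le ?m (?t *m (2 *m (adjugate (Y$i) ** \<eta>)))"
      by (rule entries_le_mono[OF small]) (use two' Yi' eta_OD in \<open>auto intro!: OD_scaleM OD_mult simp: OD_adjugate\<close>)
    ultimately have "entries_le ?m ((X i - adjugate (X i)) ** \<eta>)"
      unfolding X by (rule entries_le_diff)
    then have "entries_le ?m (\<upsilon>$i *m ((X i - adjugate (X i)) ** \<eta>))"
      using entries_le_scaleM[of ?m _ "\<upsilon>$i"] by (simp add: \<upsilon>)
    moreover have "entries_le ?m (?d *m (p *m ((E i - adjugate (E i)) ** \<eta>)))"
    proof (rule entries_le_mono[OF small])
      have "p \<in> OF" using absF_p_le by (simp add: OF_iff)
      then show "p *m ((E i - adjugate (E i)) ** \<eta>) \<in> OD"
        using E(1) eta_OD by (intro OD_scaleM OD_mult OD_diff) (simp_all add: OD_adjugate)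
    qed simp
    ultimately have "entries_le ?m ((\<gamma>'$i - adjugate (\<gamma>'$i)) ** \<eta>)"
      unfolding lin by (rule entries_le_add)
    then show "entries_le ?m (((\<gamma>' - (\<chi> i. adjugate (\<gamma>'$i))) **n \<eta>)$i)"
      by (simp add: rmultMn_def)
  qed
qed

text \<open>The bound \<open>b\<close> for a nonzero Gauss sum is the same for all \<open>A\<close>,
  so the average is at most \<open>b\<close> times the proportion of \<open>A\<close> satisfying
  \<open>in_Theta\<close>, which \<open>W\<close> dominates.\<close>

theorem I0_bound:
  assumes gen: "cyclic_generator \<eta> N0" and \<mu>: "\<mu> \<in> primitive \<pi>"
    and star: "star_condition \<pi> \<delta> \<eta> \<gamma> M0 \<mu>"
  shows "cmod (I0 dY \<psi> \<upsilon> \<delta> \<gamma>) \<le>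
    W TYPE('n) dZ \<pi> N0 M0 \<eta> * absF (det \<eta>) powr (3 * real CARD('n) / 2) * normD \<pi> \<delta> ^ CARD('n)
      / (max (normDn \<pi> ((\<gamma>' - (\<chi> i. adjugate (\<gamma>'$i))) **n \<eta>)) (absF (det \<eta>)) powr (real CARD('n) / 2)
         * max (normDn \<pi> \<gamma>') (normD \<pi> \<delta> * absF (det \<eta>)) ^ CARD('n))"
proof -
  let ?D = "absF (det \<eta>)"
  let ?m1 = "max (normDn \<pi> ((\<gamma>' - (\<chi> i. adjugate (\<gamma>'$i))) **n \<eta>)) ?D"
  let ?m2 = "max (normDn \<pi> \<gamma>') (normD \<pi> \<delta> * ?D)"
  define b where "b = ?D powr (3 * real CARD('n) / 2) * normD \<pi> \<delta> ^ CARD('n)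
      / (?m1 powr (real CARD('n) / 2) * ?m2 ^ CARD('n))"
  have dn: "0 < normD \<pi> \<delta>" using p_nz by (simp add: normD_delta)
  have b0: "0 \<le> b"
    unfolding b_def using dn by (intro divide_nonneg_nonneg mult_nonneg_nonneg) (auto simp: le_max_iff_disj)
  obtain N where N: "period N" by (rule ex_period)
  then have N': "N \<noteq> 0" "absF N \<le> 1" "absF N \<le> absF c" by (auto simp: period_def)
  obtain R1 :: "('f^2^2) set" where R1: "transversal OD {A. entries_le (absF N) A} R1"
    using transversal_OD N' by blast
  obtain R2 :: "('f^2^2^'n) set" where R2: "transversal ODn {Y. \<forall>i. entries_le (absF N) (Y$i)} R2"
    using transversal_ODn N' by blast
  have summand_le: "cmod ((\<Sum>Y\<in>R2. summand A Y) / card R2) \<le> b * of_bool (in_Theta N0 M0 \<mu> A)"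
    if "A \<in> R1" for A
  proof (cases "(\<Sum>Y\<in>R2. summand A Y) = 0")
    case False
    have A: "A \<in> OD" using that transversal.R_subset[OF R1] by blast
    obtain Y where Y: "Y \<in> ODn" "\<And>i. entries_le (absF c)
        (\<gamma>'$i - \<upsilon>$i *m (A ** adjugate \<eta> ** Y$i + Y$i ** (A ** adjugate \<eta>)))"
      using summand_nonzero[OF N R2 A False] by blast
    have th: "in_Theta N0 M0 \<mu> A" by (rule in_Theta_if_nonzero[OF gen star A Y])
    have "cmod (\<Sum>Y\<in>R2. summand A Y) / card R2 \<le> b"
      unfolding b_def
    proof (rule bound_arith)
      show "0 < ?D" using det_eta_nz by simp
      show "(cmod (\<Sum>Y\<in>R2. summand A Y) / card R2)\<^sup>2 *
          ((max (normD \<pi> (A ** adjugate \<eta>)) (absF c) / absF c)\<^sup>2 *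
            (max (absF (trace (A ** adjugate \<eta>))) (absF c) / absF c)) ^ CARD('n) \<le> 1"
        unfolding gauss_sum_summand(2)[OF N R2 A]
        by (rule gauss_sum.gauss_sum_bound[OF gauss_sum_summand(1)[OF N R2 A]])
      show "?m1 \<le> max (absF (trace (A ** adjugate \<eta>))) ?D" using gamma_bounds(2)[OF A Y] by simp
      show "?m2 \<le> max (normD \<pi> (A ** adjugate \<eta>)) (absF c)"
        using gamma_bounds(1)[OF A Y] by (simp add: absF_c_eq)
    qed (use dn absF_c_eq absF_c_le in auto)
    then show ?thesis using th by (simp add: norm_divide)
  qed (use b0 in simp)
  have N0: "N0 \<in> OD" using gen by (simp add: cyclic_generator_def)
  have "cmod (I0 dY \<psi> \<upsilon> \<delta> \<gamma>) = cmod (\<Sum>A\<in>R1. (\<Sum>Y\<in>R2. summand A Y) / card R2) / card R1"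
    unfolding I0_eq[OF N R1 R2] by (simp add: norm_divide)
  also have "\<dots> \<le> (\<Sum>A\<in>R1. b * of_bool (in_Theta N0 M0 \<mu> A)) / card R1"
    by (intro divide_right_mono sum_norm_le summand_le) auto
  also have "\<dots> = b * ((\<Sum>A\<in>R1. of_bool (in_Theta N0 M0 \<mu> A)) / card R1)"
    by (simp add: sum_distrib_left)
  also have "\<dots> \<le> b * W TYPE('n) dZ \<pi> N0 M0 \<eta>"
    by (intro mult_left_mono W_ge[OF N'(1,3) N0 \<mu> R1] b0)
  finally show ?thesis by (simp add: b_def mult_ac)
qed

end

theorem theorem8p2:
  fixes \<pi> :: "'f::nonarch_local_field"
    and \<psi> :: "'f \<Rightarrow> complex"
    and \<upsilon> :: "'f^'n"
    and dY :: "('f^2^2^'n) measure"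
    and dZ :: "('f^2^2) measure"
    and \<delta> \<eta> :: "'f^2^2"
    and \<gamma> :: "'f^2^2^'n"
  assumes "odd (residue_char TYPE('f))"
    and "uniformizer \<pi>"
    and "additive_character \<psi>"
    and "unramified \<pi> \<psi>"
    and "\<And>i. absF (\<upsilon>$i) = 1"
    and "haar_measure ODn dY"
    and "haar_measure OD dZ"
    and "\<delta> \<in> OD" and "invertible \<delta>"
    and "\<delta> = \<pi> powi (valD \<pi> \<delta>) *m \<eta>"
  shows "(I0 dY \<psi> \<upsilon> \<delta> \<gamma> \<noteq> 0 \<longrightarrow>
      \<gamma> \<in> (*mn) (\<pi> powi (valD \<pi> \<delta>)) ` ODn \<and>
      (\<exists>M0\<in>OD. \<exists>\<mu>\<in>primitive \<pi>. star_condition \<pi> \<delta> \<eta> \<gamma> M0 \<mu>)) \<and>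
    (\<forall>N0 M0 \<mu> \<gamma>'.
      cyclic_generator \<eta> N0 \<longrightarrow>
      M0 \<in> OD \<longrightarrow> \<mu> \<in> primitive \<pi> \<longrightarrow>
      \<gamma> \<in> (*mn) (\<pi> powi (valD \<pi> \<delta>)) ` ODn \<longrightarrow>
      \<gamma>' = \<pi> powi (- valD \<pi> \<delta>) *mn \<gamma> \<longrightarrow>
      star_condition \<pi> \<delta> \<eta> \<gamma> M0 \<mu> \<longrightarrow>
      cmod (I0 dY \<psi> \<upsilon> \<delta> \<gamma>) \<le>
        W TYPE('n) dZ \<pi> N0 M0 \<eta> * absF (det \<eta>) powr (3 * real CARD('n) / 2)
          * normD \<pi> \<delta> ^ CARD('n)
        / (max (normDn \<pi> ((\<gamma>' - (\<chi> i. adjugate (\<gamma>'$i))) **n \<eta>)) (absF (det \<eta>))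
              powr (real CARD('n) / 2)
           * max (normDn \<pi> \<gamma>') (normD \<pi> \<delta> * absF (det \<eta>)) ^ CARD('n)))"
proof -
  interpret quadratic_integral \<pi> \<psi> \<upsilon> dY dZ \<delta> \<eta> \<gamma>
    using assms(2-) absF_2[OF assms(1)] by unfold_locales auto
  show ?thesis
    using I0_nonzero I0_bound gamma_in_iff unfolding p_def \<gamma>'_def by blast
qed

end
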